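(* Let $0<\mu<L$, let $K\ge2$ be an integer, and let $(\gamma,\beta)$ belong to the interior (in $\mathbb R^2$) of $\Omega_{K\text{-}\circ}(\mathcal F_{\mu,L})$. Then: 1. there exist $\tau>0$ and a function $\varphi\in\mathcal F^\tau_{\mu,L}$ such that $\mathrm{HB}_{\gamma,\beta}(\varphi)$ cycles on the roots-of-unity cycle $(x_0^\circ,\dots,x_{K-1}^\circ)$; 2. moreover, for any $\tau>0$, $\mathrm{HB}_{\gamma,\beta}$ has a cycle on $\mathcal F^\tau_{\mu,L}$.
   Context: For $0<\mu\le L$, $\mathcal F_{\mu,L}$ is the set of continuously differentiable functions $f:\mathbb R^d\to\mathbb R$ ($d\ge1$ arbitrary) with $f(x)\le f(y)+\langle\nabla f(y),x-y\rangle+\frac L2\|x-y\|^2$ and $f(x)\ge f(y)+\langle\nabla f(y),x-y\rangle+\frac\mu2\|x-y\|^2$ for all $x,y$. $\mathcal F^\tau_{\mu,L}$ is the set of $f\in\mathcal F_{\mu,L}$ that are three times differentiable with $\tau$-Lipschitz Hessian: $\|\nabla^2f(z)-\nabla^2f(w)\|\le\tau\|z-w\|$ for all $z,w$. For $\gamma,\beta\in\mathbb R$ and differentiable $f$, $\mathrm{HB}_{\gamma,\beta}(f)$ is the iteration $z_{t+1}=z_t-\gamma\nabla f(z_t)+\beta(z_t-z_{t-1})$, $t\ge1$, from initial points $z_0,z_1$. For an integer $K$ and $K$ points $(x_0,\dots,x_{K-1})$ not all equal, $\mathrm{HB}_{\gamma,\beta}(f)$ cycles on $(x_0,\dots,x_{K-1})$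 if the sequence initialized at $z_0=x_0,z_1=x_1$ satisfies $z_t=x_{t\bmod K}$ for all $t\ge0$. $\mathrm{HB}_{\gamma,\beta}$ has a cycle on a class $\mathcal F$ if there exist an integer $K$, points $(x_0,\dots,x_{K-1})$ not all equal, and $f\in\mathcal F$ such that $\mathrm{HB}_{\gamma,\beta}(f)$ cycles on $(x_0,\dots,x_{K-1})$. $\Omega_{\mathrm{cv}}(\mathcal Q_{\mu,L})=\{(\gamma,\beta):\beta\in(-1,1),\ 0<\gamma<\frac2L(1+\beta)\}$. With $\theta_K=2\pi/K$, $x_t^\circ=(\cos(t\theta_K),\sin(t\theta_K))^\top\in\mathbb R^2$, $t=0,\dots,K-1$. $\Omega_{K\text{-}\circ}(\mathcal F_{\mu,L})$ is the set of $(\gamma,\beta)\in\Omega_{\mathrm{cv}}(\mathcal Q_{\mu,L})$ for which there is $f\in\mathcal F_{\mu,L}$ on $\mathbb R^2$ such that $\mathrm{HB}_{\gamma,\beta}(f)$ cycles on $(x_0^\circ,\dots,x_{K-1}^\circ)$. *)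

theory Defs
  imports "HOL-Analysis.Analysis"
begin

section \<open>Euclidean spaces of all dimensions inside one type\<close>

text \<open>
  The notion "the heavy-ball method has a cycle on a class" quantifies existentially over the
  dimension d of the ambient space, so the dimension cannot be a type there.  We use the inner
  product space of finitely supported real sequences and represent Euclidean d-space by the
  subspace of the sequences supported in the first d positions.
\<close>

typedef fin_seq = "{x :: nat \<Rightarrow> real. finite {i. x i \<noteq> 0}}"
  morphisms coord Abs_fin_seq
  by (rule exI[of _ "\<lambda>_. 0"]) simp

lemma finite_coord [simp]: "finite {i. coord x i \<noteq> 0}"
  using coord[of x] by simp

lemma fin_seq_eqI: "(\<And>i. coord x i = coord y i) \<Longrightarrow> x = y"
  by (simp add: coord_inject[symmetric] fun_eq_iff)

instantiation fin_seq :: real_vector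
begin

definition "0 = Abs_fin_seq (\<lambda>_. 0)"
definition "x + y = Abs_fin_seq (\<lambda>i. coord x i + coord y i)"
definition "- x = Abs_fin_seq (\<lambda>i. - coord x i)"
definition "x - y = Abs_fin_seq (\<lambda>i. coord x i - coord y i)"
definition "c *\<^sub>R x = Abs_fin_seq (\<lambda>i. c * coord x i)"

lemma coord_simps [simp]:
  "coord 0 i = 0"
  "coord (x + y) i = coord x i + coord y i"
  "coord (- x) i = - coord x i"
  "coord (x - y) i = coord x i - coord y i"
  "coord (c *\<^sub>R x) i = c * coord x i"
proof -
  have fin: "finite {i. coord x i \<noteq> 0 \<or> coord y i \<noteq> 0}"
    using finite_UnI[OF finite_coord[of x] finite_coord[of y]] by (simp only: Collect_disj_eq)
  show "coord 0 i = 0"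
    by (simp add: zero_fin_seq_def Abs_fin_seq_inverse)
  show "coord (x + y) i = coord x i + coord y i"
    unfolding plus_fin_seq_def
    by (subst Abs_fin_seq_inverse) (auto intro: finite_subset[OF _ fin])
  show "coord (- x) i = - coord x i"
    by (simp add: uminus_fin_seq_def Abs_fin_seq_inverse)
  show "coord (x - y) i = coord x i - coord y i"
    unfolding minus_fin_seq_def
    by (subst Abs_fin_seq_inverse) (auto intro: finite_subset[OF _ fin])
  show "coord (c *\<^sub>R x) i = c * coord x i"
    unfolding scaleR_fin_seq_def
    by (subst Abs_fin_seq_inverse) (auto intro: finite_subset[OF _ fin])
qed

instance
  by standard (auto intro!: fin_seq_eqI simp: algebra_simps)

end

instantiation fin_seq :: real_inner
begin

definition inner_fin_seq :: "fin_seq \<Rightarrow> fin_seq \<Rightarrow> real"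
  where "inner x y = (\<Sum>i | coord x i \<noteq> 0. coord x i * coord y i)"
definition norm_fin_seq :: "fin_seq \<Rightarrow> real"
  where "norm x = sqrt (inner x (x :: fin_seq))"
definition sgn_fin_seq :: "fin_seq \<Rightarrow> fin_seq"
  where "sgn (x :: fin_seq) = x /\<^sub>R norm x"
definition dist_fin_seq :: "fin_seq \<Rightarrow> fin_seq \<Rightarrow> real"
  where "dist x y = norm (x - y :: fin_seq)"
definition uniformity_fin_seq :: "(fin_seq \<times> fin_seq) filter"
  where "uniformity = (INF e\<in>{0 <..}. principal {(x :: fin_seq, y). dist x y < e})"
definition open_fin_seq :: "fin_seq set \<Rightarrow> bool"
  where "open (U :: fin_seq set) \<longleftrightarrow> (\<forall>x\<in>U. eventually (\<lambda>(x', y). x' = x \<longrightarrow> y \<in> U) uniformity)"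

lemma inner_fin_seq_eq_sum:
  assumes "finite A" "{i. coord x i \<noteq> 0} \<subseteq> A"
  shows "inner x y = (\<Sum>i\<in>A. coord x i * coord y i)"
  unfolding inner_fin_seq_def using assms by (intro sum.mono_neutral_left) auto

instance
proof
  fix x y z :: fin_seq and r :: real
  define A where "A = {i. coord x i \<noteq> 0} \<union> {i. coord y i \<noteq> 0}"
  have A: "finite A" "{i. coord x i \<noteq> 0} \<subseteq> A" "{i. coord y i \<noteq> 0} \<subseteq> A"
    "{i. coord (x + y) i \<noteq> 0} \<subseteq> A" "{i. coord (r *\<^sub>R x) i \<noteq> 0} \<subseteq> A"
    by (auto simp: A_def)
  note expand = A(2-5)[THEN inner_fin_seq_eq_sum[OF A(1)]]
  show "inner x y = inner y x"
    by (simp only: expand) (simp add: mult.commute)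
  show "inner (x + y) z = inner x z + inner y z"
    by (simp only: expand) (simp add: distrib_right sum.distrib)
  show "inner (r *\<^sub>R x) y = r * inner x y"
    by (simp only: expand) (simp add: sum_distrib_left mult.assoc)
  show "0 \<le> inner x x"
    by (simp add: inner_fin_seq_def sum_nonneg)
  show "inner x x = 0 \<longleftrightarrow> x = 0"
  proof
    assume "inner x x = 0"
    then have "\<forall>i\<in>{i. coord x i \<noteq> 0}. coord x i * coord x i = 0"
      unfolding inner_fin_seq_def by (subst (asm) sum_nonneg_eq_0_iff) auto
    then show "x = 0"
      by (auto intro: fin_seq_eqI)
  qed (simp add: inner_fin_seq_def)
qed (rule sgn_fin_seq_def dist_fin_seq_def uniformity_fin_seq_def open_fin_seq_def
      norm_fin_seq_def)+

end

definition Rd :: "nat \<Rightarrow> fin_seq set"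
  where "Rd d = {x. \<forall>i\<ge>d. coord x i = 0}"

lemma subspace_Rd: "subspace (Rd d)"
  by (auto simp: subspace_def Rd_def)

lemma inner_Rd: "x \<in> Rd d \<Longrightarrow> inner x y = (\<Sum>i<d. coord x i * coord y i)"
  by (rule inner_fin_seq_eq_sum) (auto simp: Rd_def not_le[symmetric])


section \<open>Function classes\<close>

text \<open>
  In what follows \<^term>\<open>E\<close> is a Euclidean space, given as a finite-dimensional subspace of some
  inner product space: \<^term>\<open>Rd d\<close>, or the whole of a Euclidean type.  Only the values on
  \<^term>\<open>E\<close> of a function matter, and all derivatives are taken within \<^term>\<open>E\<close>.
  The gradient exists wherever the function is differentiable within \<^term>\<open>E\<close>, because
  \<^term>\<open>E\<close> is finite-dimensional; it is unique by the lemma \<open>grad_eqI\<close>.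
\<close>

definition grad :: "'a::real_inner set \<Rightarrow> ('a \<Rightarrow> real) \<Rightarrow> 'a \<Rightarrow> 'a"
  where "grad E f x = (THE g. g \<in> E \<and> (f has_derivative (\<lambda>h. inner h g)) (at x within E))"

lemma grad_eqI:
  fixes E :: "'a::real_inner set"
  assumes E: "subspace E" and "x \<in> E" "g \<in> E"
    and "(f has_derivative (\<lambda>h. inner h g)) (at x within E)"
  shows "grad E f x = g"
  unfolding grad_def
proof (rule the_equality)
  fix g' assume g': "g' \<in> E \<and> (f has_derivative (\<lambda>h. inner h g')) (at x within E)"
  define v where "v = g' - g"
  have v: "v \<in> E"
    using E g' assms by (simp add: v_def subspace_diff)
  have line: "((\<lambda>t. x + t *\<^sub>R v) has_derivative (\<lambda>t. t *\<^sub>R v)) (at 0 within UNIV)"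
    by (auto intro!: derivative_eq_intros)
  have sub: "(\<lambda>t. x + t *\<^sub>R v) ` UNIV \<subseteq> E"
    using E v assms by (auto intro: subspace_add subspace_scale)
  have *: "((\<lambda>t. f (x + t *\<^sub>R v)) has_derivative (\<lambda>t. inner (t *\<^sub>R v) u)) (at 0)"
    if "(f has_derivative (\<lambda>h. inner h u)) (at x within E)" for u
    using has_derivative_in_compose[OF line, of f "\<lambda>h. inner h u"] 
      has_derivative_subset[OF _ sub, of f "\<lambda>h. inner h u" x] that by simp
  have "(\<lambda>t. inner (t *\<^sub>R v) g) = (\<lambda>t. inner (t *\<^sub>R v) g')"
    using *[of g] *[of g'] assms g' has_derivative_unique by blast
  then have "inner v g = inner v g'"
    by (metis scaleR_one)
  then have "inner v v = 0"
    by (simp add: v_def inner_diff_right)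
  then show "g' = g"
    by (simp add: v_def)
qed (use assms in simp)

lemma grad_UNIV_eqI: "GDERIV f x :> g \<Longrightarrow> grad UNIV f x = g"
  by (rule grad_eqI) (auto simp: gderiv_def)

definition F_class :: "'a::real_inner set \<Rightarrow> real \<Rightarrow> real \<Rightarrow> ('a \<Rightarrow> real) set"
  where "F_class E \<mu> L = {f.
    f differentiable_on E \<and> continuous_on E (grad E f) \<and>
    (\<forall>x\<in>E. \<forall>y\<in>E. f x \<le> f y + inner (grad E f y) (x - y) + L / 2 * (norm (x - y))\<^sup>2) \<and>
    (\<forall>x\<in>E. \<forall>y\<in>E. f x \<ge> f y + inner (grad E f y) (x - y) + \<mu> / 2 * (norm (x - y))\<^sup>2)}"

text \<open>
  The Hessian is the derivative of the gradient, with the operator norm.  If \<^term>\<open>E\<close> is a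
  proper subspace, \<^term>\<open>H x\<close> is determined on \<^term>\<open>E\<close> only; the existential quantifier makes
  the bound the one for the operator norm on \<^term>\<open>E\<close>, because precomposing with the orthogonal
  projection onto \<^term>\<open>E\<close> extends every \<^term>\<open>H x\<close> without changing norms of differences.
\<close>

definition F_tau_class :: "'a::real_inner set \<Rightarrow> real \<Rightarrow> real \<Rightarrow> real \<Rightarrow> ('a \<Rightarrow> real) set"
  where "F_tau_class E \<mu> L \<tau> = {f \<in> F_class E \<mu> L.
    \<exists>H :: 'a \<Rightarrow> 'a \<Rightarrow>\<^sub>L 'a.
      (\<forall>x\<in>E. (grad E f has_derivative blinfun_apply (H x)) (at x within E)) \<and>
      H differentiable_on E \<and>
      (\<forall>z\<in>E. \<forall>w\<in>E. norm (H z - H w) \<le> \<tau> * norm (z - w))}"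


section \<open>The heavy-ball method and its cycles\<close>

fun HB :: "'a::real_inner set \<Rightarrow> real \<Rightarrow> real \<Rightarrow> ('a \<Rightarrow> real) \<Rightarrow> 'a \<Rightarrow> 'a \<Rightarrow> nat \<Rightarrow> 'a"
  where
    "HB E \<gamma> \<beta> f z0 z1 0 = z0"
  | "HB E \<gamma> \<beta> f z0 z1 (Suc 0) = z1"
  | "HB E \<gamma> \<beta> f z0 z1 (Suc (Suc t)) =
       HB E \<gamma> \<beta> f z0 z1 (Suc t) - \<gamma> *\<^sub>R grad E f (HB E \<gamma> \<beta> f z0 z1 (Suc t))
       + \<beta> *\<^sub>R (HB E \<gamma> \<beta> f z0 z1 (Suc t) - HB E \<gamma> \<beta> f z0 z1 t)"

text \<open>
  The tuple of points is the restriction of \<^term>\<open>x\<close> to the indices below \<^term>\<open>K\<close>.  As the points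
  are not all equal, \<^term>\<open>K \<ge> 2\<close>, so that \<^term>\<open>x 1\<close> is one of them.
\<close>

definition HB_cycles_on ::
    "'a::real_inner set \<Rightarrow> real \<Rightarrow> real \<Rightarrow> ('a \<Rightarrow> real) \<Rightarrow> nat \<Rightarrow> (nat \<Rightarrow> 'a) \<Rightarrow> bool"
  where "HB_cycles_on E \<gamma> \<beta> f K x \<longleftrightarrow>
    (\<forall>i<K. x i \<in> E) \<and> (\<exists>i<K. \<exists>j<K. x i \<noteq> x j) \<and>
    (\<forall>t. HB E \<gamma> \<beta> f (x 0) (x 1) t = x (t mod K))"

text \<open>A class of functions is given by its members on \<^term>\<open>Rd d\<close> for each dimension \<^term>\<open>d\<close>.\<close>

definition HB_has_cycle :: "real \<Rightarrow> real \<Rightarrow> (nat \<Rightarrow> (fin_seq \<Rightarrow> real) set) \<Rightarrow> bool"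
  where "HB_has_cycle \<gamma> \<beta> \<F> \<longleftrightarrow>
    (\<exists>d\<ge>1. \<exists>K x. \<exists>f\<in>\<F> d. HB_cycles_on (Rd d) \<gamma> \<beta> f K x)"

definition \<Omega>_cv :: "real \<Rightarrow> (real \<times> real) set"
  where "\<Omega>_cv L = {(\<gamma>, \<beta>). \<beta> \<in> {-1<..<1} \<and> 0 < \<gamma> \<and> \<gamma> < 2 / L * (1 + \<beta>)}"

definition roots_cycle :: "nat \<Rightarrow> nat \<Rightarrow> real^2"
  where "roots_cycle K t =
    vector [cos (real t * (2 * pi / real K)), sin (real t * (2 * pi / real K))]"

definition \<Omega>_circ :: "nat \<Rightarrow> real \<Rightarrow> real \<Rightarrow> (real \<times> real) set"
  where "\<Omega>_circ K \<mu> L = {(\<gamma>, \<beta>) \<in> \<Omega>_cv L.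
    \<exists>f \<in> F_class (UNIV :: (real^2) set) \<mu> L. HB_cycles_on UNIV \<gamma> \<beta> f K (roots_cycle K)}"

end

theory Submission
  imports Defs
begin

text \<open>
  On the roots-of-unity cycle the heavy-ball recursion prescribes the gradients at the cycle points,
  as a linear function of \<open>(1/\<gamma>, \<beta>/\<gamma>)\<close>.  Moving \<open>(\<gamma>, \<beta>)\<close> slightly inside the interior and averaging
  the function obtained there with a small multiple of \<open>\<parallel>\<cdot>\<parallel>\<^sup>2\<close> yields a function with the cycle for
  the original \<open>(\<gamma>, \<beta>)\<close> whose convexity and smoothness constants lie strictly between \<open>\<mu>\<close> and \<open>L\<close>.
  Mollification keeps these constants, gives a Lipschitz Hessian, and changes the gradients at the
  cycle points by arbitrarily little; the error is corrected exactly by ridge functions with small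
  Hessian, which fits into the room left in the constants.  Finally \<open>\<rho>\<^sup>2 \<phi>(x / \<rho>)\<close> has the same
  constants as \<open>\<phi>\<close>, the cycle scaled by \<open>\<rho>\<close>, and a Hessian whose Lipschitz constant is divided
  by \<open>\<rho>\<close>.
\<close>

section \<open>Two-sided quadratic bounds\<close>

text \<open>The gradient is an explicit argument, which avoids the definite description in
  \<open>grad\<close> when functions are added or averaged. The constants carry no sign condition,
  so a small perturbation with bounds \<open>- c\<close> and \<open>c\<close> fits the same
  predicate. Requiring \<open>G x \<in> E\<close> makes \<open>G\<close> agree with
  \<open>grad E f\<close> on a proper subspace.\<close>

definition quad_bounds ::
    "'a::real_inner set \<Rightarrow> ('a \<Rightarrow> real) \<Rightarrow> ('a \<Rightarrow> 'a) \<Rightarrow> real \<Rightarrow> real \<Rightarrow> bool"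
  where "quad_bounds E f G a b \<longleftrightarrow> (\<forall>x\<in>E. G x \<in> E) \<and>
    (\<forall>x\<in>E. \<forall>y\<in>E. a / 2 * (norm (x - y))\<^sup>2 \<le> f x - f y - inner (G y) (x - y) \<and>
       f x - f y - inner (G y) (x - y) \<le> b / 2 * (norm (x - y))\<^sup>2)"

lemma quad_boundsD:
  assumes "quad_bounds E f G a b" "x \<in> E" "y \<in> E"
  shows "a / 2 * (norm (x - y))\<^sup>2 \<le> f x - f y - inner (G y) (x - y)"
    and "f x - f y - inner (G y) (x - y) \<le> b / 2 * (norm (x - y))\<^sup>2"
    and "G x \<in> E"
  using assms by (auto simp: quad_bounds_def)

lemma quad_bounds_add:
  assumes "subspace E" "quad_bounds E f F a b" "quad_bounds E g G c d"
  shows "quad_bounds E (\<lambda>x. f x + g x) (\<lambda>x. F x + G x) (a + c) (b + d)"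
  unfolding quad_bounds_def
proof (intro conjI ballI)
  fix x y assume "x \<in> E" "y \<in> E"
  then show "(a + c) / 2 * (norm (x - y))\<^sup>2 \<le> f x + g x - (f y + g y) - inner (F y + G y) (x - y)"
    "f x + g x - (f y + g y) - inner (F y + G y) (x - y) \<le> (b + d) / 2 * (norm (x - y))\<^sup>2"
    using quad_boundsD(1,2)[OF assms(2), of x y] quad_boundsD(1,2)[OF assms(3), of x y]
    by (auto simp: inner_add_left ring_distribs add_divide_distrib)
qed (blast intro: subspace_add[OF assms(1)] quad_boundsD(3)[OF assms(2)] quad_boundsD(3)[OF assms(3)])

lemma quad_bounds_scaleR:
  assumes "subspace E" "quad_bounds E f F a b" "0 \<le> c"
  shows "quad_bounds E (\<lambda>x. c * f x) (\<lambda>x. c *\<^sub>R F x) (c * a) (c * b)"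
  unfolding quad_bounds_def
proof (intro conjI ballI)
  fix x y assume "x \<in> E" "y \<in> E"
  then show "c * a / 2 * (norm (x - y))\<^sup>2 \<le> c * f x - c * f y - inner (c *\<^sub>R F y) (x - y)"
    "c * f x - c * f y - inner (c *\<^sub>R F y) (x - y) \<le> c * b / 2 * (norm (x - y))\<^sup>2"
    using quad_boundsD(1,2)[OF assms(2), of x y, THEN mult_left_mono, OF _ _ assms(3)]
    by (auto simp: algebra_simps)
qed (blast intro: subspace_scale[OF assms(1)] quad_boundsD(3)[OF assms(2)])

lemma quad_bounds_norm_square: "quad_bounds UNIV (\<lambda>x::'a::real_inner. (norm x)\<^sup>2 / 2) (\<lambda>x. x) 1 1"
  unfolding quad_bounds_def
  by (auto simp: power2_norm_eq_inner inner_diff_left inner_diff_right inner_commute field_simps)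

lemma quad_bounds_abs:
  assumes "quad_bounds E f G a b" "x \<in> E" "y \<in> E"
  shows "\<bar>f x - f y - inner (G y) (x - y)\<bar> \<le> (\<bar>a\<bar> + \<bar>b\<bar>) * (norm (x - y))\<^sup>2"
proof -
  have "\<bar>a\<bar> * (norm (x - y))\<^sup>2 \<ge> 0" "\<bar>b\<bar> * (norm (x - y))\<^sup>2 \<ge> 0"
    by auto
  moreover have "- (\<bar>a\<bar> * (norm (x - y))\<^sup>2) \<le> a * (norm (x - y))\<^sup>2"
    "b * (norm (x - y))\<^sup>2 \<le> \<bar>b\<bar> * (norm (x - y))\<^sup>2"
    unfolding mult_minus_left[symmetric] by (intro mult_right_mono; simp)+
  ultimately show ?thesis
    using quad_boundsD(1,2)[OF assms] unfolding abs_le_iff ring_distribs by (intro conjI; linarith)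
qed

text \<open>The first-order remainder is at most quadratic, so the difference quotient is squeezed
  by a multiple of \<open>norm (x - y)\<close>. Differentiability is a consequence of the bounds and
  is never assumed separately.\<close>

lemma quad_bounds_has_derivative:
  assumes "quad_bounds E f G a b" "y \<in> E"
  shows "(f has_derivative (\<lambda>h. inner h (G y))) (at y within E)"
proof (rule has_derivativeI_sandwich[where e = 1 and H = "\<lambda>x. (\<bar>a\<bar> + \<bar>b\<bar>) * norm (x - y)"])
  fix x assume x: "x \<in> E" "x \<noteq> y"
  then show "norm (f x - f y - inner (x - y) (G y)) / norm (x - y) \<le> (\<bar>a\<bar> + \<bar>b\<bar>) * norm (x - y)"
    using quad_bounds_abs[OF assms(1) x(1) assms(2)]
    by (simp add: inner_commute divide_le_eq power2_eq_square mult.assoc)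
next
  show "((\<lambda>x. (\<bar>a\<bar> + \<bar>b\<bar>) * norm (x - y)) \<longlongrightarrow> 0) (at y within E)"
    by (rule tendsto_eq_intros refl | simp)+
qed (auto intro: bounded_linear_inner_left)

lemma quad_bounds_grad:
  assumes "subspace E" "quad_bounds E f G a b" "x \<in> E"
  shows "grad E f x = G x"
  using assms by (intro grad_eqI quad_bounds_has_derivative) (auto simp: quad_bounds_def)

text \<open>
  The left-hand side, tested against a vector of norm \<open>\<parallel>x - y\<parallel>\<close> in the direction of
  \<open>G x - G y\<close>, is a combination of the three first-order remainders between \<open>x\<close>, \<open>y\<close> and
  the displaced point \<open>z\<close>.
\<close>

lemma quad_bounds_lipschitz:
  assumes E: "subspace E" and f: "quad_bounds E f G a b"
  shows "(6 * (\<bar>a\<bar> + \<bar>b\<bar>))-lipschitz_on E G"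
proof (rule lipschitz_onI)
  fix x y assume x: "x \<in> E" and y: "y \<in> E"
  show "dist (G x) (G y) \<le> 6 * (\<bar>a\<bar> + \<bar>b\<bar>) * dist x y"
  proof (cases "G x = G y \<or> x = y")
    case False
    define C where "C = \<bar>a\<bar> + \<bar>b\<bar>"
    define d where "d = norm (x - y)"
    define w where "w = (d / norm (G x - G y)) *\<^sub>R (G x - G y)"
    define z where "z = x + w"
    have d: "d > 0" and n: "norm (G x - G y) > 0"
      using False by (auto simp: d_def)
    have w: "norm w = d"
      using n d by (simp add: w_def)
    have z: "z \<in> E"
      using E f x y unfolding z_def w_def quad_bounds_def
      by (intro subspace_add subspace_scale subspace_diff) auto
    have "norm (z - y) \<le> d + d"
      using norm_triangle_ineq[of "x - y" w] w by (simp add: z_def d_def algebra_simps)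
    then have zy: "(norm (z - y))\<^sup>2 \<le> 4 * d\<^sup>2"
      using power_mono[of "norm (z - y)" "d + d" 2] by (simp add: power2_eq_square)
    have C: "C \<ge> 0"
      by (simp add: C_def)
    have "inner (G x - G y) w =
        (f z - f y - inner (G y) (z - y)) - (f z - f x - inner (G x) (z - x))
        - (f x - f y - inner (G y) (x - y))"
      by (simp add: z_def inner_diff_left inner_diff_right inner_add_right)
    also have "\<dots> \<le> C * (norm (z - y))\<^sup>2 + C * d\<^sup>2 + C * d\<^sup>2"
      using quad_bounds_abs[OF f z y] quad_bounds_abs[OF f z x] quad_bounds_abs[OF f x y] w
      unfolding C_def[symmetric] d_def[symmetric] by (simp add: z_def)
    \<comment> \<open>The constant is 4 + 1 + 1: the displaced point is at distance at most
      \<open>2 * d\<close> from \<open>y\<close>, and the other two remainders have length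
      \<open>d\<close>.\<close>
    also have "\<dots> \<le> 6 * C * d\<^sup>2"
      using mult_left_mono[OF zy C] by simp
    also have "inner (G x - G y) w = d * norm (G x - G y)"
      using n by (simp add: w_def power2_norm_eq_inner[symmetric] power2_eq_square)
    finally have "d * norm (G x - G y) \<le> d * (6 * C * d)"
      by (simp add: power2_eq_square algebra_simps)
    then show ?thesis
      using d by (simp add: C_def d_def dist_norm)
  qed auto
qed simp

lemma quad_bounds_continuous_on:
  assumes "subspace E" "quad_bounds E f G a b"
  shows "continuous_on E G"
  using quad_bounds_lipschitz[OF assms] by (rule lipschitz_on_continuous_on)

lemma quad_bounds_imp_F_class:
  assumes E: "subspace E" and f: "quad_bounds E f G a b"
  shows "f \<in> F_class E a b"
proof -
  note grad = quad_bounds_grad[OF E f]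
  have "continuous_on E (grad E f)"
    using quad_bounds_continuous_on[OF E f] grad by (simp cong: continuous_on_cong)
  moreover have "f differentiable_on E"
    using quad_bounds_has_derivative[OF f] by (auto simp: differentiable_on_def differentiable_def)
  ultimately show ?thesis
    using quad_boundsD(1,2)[OF f] by (fastforce simp: F_class_def grad algebra_simps)
qed

lemma F_class_imp_quad_bounds:
  assumes "f \<in> F_class UNIV a b"
  shows "quad_bounds UNIV f (grad UNIV f) a b"
  unfolding quad_bounds_def
proof (intro conjI ballI)
  fix x y :: 'a
  have "f x \<le> f y + inner (grad UNIV f y) (x - y) + b / 2 * (norm (x - y))\<^sup>2"
    "f x \<ge> f y + inner (grad UNIV f y) (x - y) + a / 2 * (norm (x - y))\<^sup>2"
    using assms by (auto simp: F_class_def)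
  then show "a / 2 * (norm (x - y))\<^sup>2 \<le> f x - f y - inner (grad UNIV f y) (x - y)"
    "f x - f y - inner (grad UNIV f y) (x - y) \<le> b / 2 * (norm (x - y))\<^sup>2"
    by linarith+
qed simp

lemma quad_bounds_mono:
  assumes "quad_bounds E f G a b" "a' \<le> a" "b \<le> b'"
  shows "quad_bounds E f G a' b'"
  unfolding quad_bounds_def
proof (intro conjI ballI)
  fix x y assume xy: "x \<in> E" "y \<in> E"
  have "a' * (norm (x - y))\<^sup>2 \<le> a * (norm (x - y))\<^sup>2" "b * (norm (x - y))\<^sup>2 \<le> b' * (norm (x - y))\<^sup>2"
    using assms(2,3) by (auto intro: mult_right_mono)
  then show "a' / 2 * (norm (x - y))\<^sup>2 \<le> f x - f y - inner (G y) (x - y)"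
    "f x - f y - inner (G y) (x - y) \<le> b' / 2 * (norm (x - y))\<^sup>2"
    using quad_boundsD(1,2)[OF assms(1) xy] by auto
qed (blast intro: quad_boundsD(3)[OF assms(1)])

text \<open>Phrased for a vector field, since mollification, correction and rescaling act on
  gradients directly; \<open>F_tau_classI\<close> leads back to functions.\<close>

definition lip_hessian :: "'a::real_inner set \<Rightarrow> ('a \<Rightarrow> 'a) \<Rightarrow> real \<Rightarrow> bool"
  where "lip_hessian E G \<tau> \<longleftrightarrow> (\<exists>H :: 'a \<Rightarrow> 'a \<Rightarrow>\<^sub>L 'a.
      (\<forall>x\<in>E. (G has_derivative blinfun_apply (H x)) (at x within E)) \<and>
      H differentiable_on E \<and> (\<forall>z\<in>E. \<forall>w\<in>E. norm (H z - H w) \<le> \<tau> * norm (z - w)))"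

lemma F_tau_classI:
  assumes E: "subspace E" and f: "quad_bounds E f G a b" and G: "lip_hessian E G \<tau>"
  shows "f \<in> F_tau_class E a b \<tau>"
proof -
  obtain H :: "'a \<Rightarrow> 'a \<Rightarrow>\<^sub>L 'a" where H: "\<forall>x\<in>E. (G has_derivative H x) (at x within E)"
    "H differentiable_on E" "\<forall>z\<in>E. \<forall>w\<in>E. norm (H z - H w) \<le> \<tau> * norm (z - w)"
    using G unfolding lip_hessian_def by blast
  have "(grad E f has_derivative H x) (at x within E)" if "x \<in> E" for x
    using H(1) that by (intro has_derivative_transform[OF that quad_bounds_grad[OF E f]]) blast+
  then show ?thesis
    using H(2,3) quad_bounds_imp_F_class[OF E f] unfolding F_tau_class_def by blast
qed

lemma lip_hessian_add:
  assumes "lip_hessian E F \<sigma>" "lip_hessian E G \<tau>"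
  shows "lip_hessian E (\<lambda>x. F x + G x) (\<sigma> + \<tau>)"
proof -
  obtain H :: "'a \<Rightarrow> 'a \<Rightarrow>\<^sub>L 'a" where H: "\<forall>x\<in>E. (F has_derivative H x) (at x within E)"
    "H differentiable_on E" "\<forall>z\<in>E. \<forall>w\<in>E. norm (H z - H w) \<le> \<sigma> * norm (z - w)"
    using assms(1) unfolding lip_hessian_def by blast
  obtain J :: "'a \<Rightarrow> 'a \<Rightarrow>\<^sub>L 'a" where J: "\<forall>x\<in>E. (G has_derivative J x) (at x within E)"
    "J differentiable_on E" "\<forall>z\<in>E. \<forall>w\<in>E. norm (J z - J w) \<le> \<tau> * norm (z - w)"
    using assms(2) unfolding lip_hessian_def by blast
  show ?thesis
    unfolding lip_hessian_def
  proof (intro exI[of _ "\<lambda>x. H x + J x"] conjI ballI)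
    fix x assume "x \<in> E"
    then show "((\<lambda>x. F x + G x) has_derivative H x + J x) (at x within E)"
      using H(1) J(1) by (auto simp: plus_blinfun.rep_eq intro!: derivative_eq_intros)
  next
    fix z w assume "z \<in> E" "w \<in> E"
    then show "norm (H z + J z - (H w + J w)) \<le> (\<sigma> + \<tau>) * norm (z - w)"
      using H(3)[rule_format, of z w] J(3)[rule_format, of z w]
        norm_triangle_ineq[of "H z - H w" "J z - J w"] by (simp add: algebra_simps)
  qed (use H J in auto)
qed

section \<open>Mollification\<close>

text \<open>The rank-one operator written \<open>b u^T\<close> in matrix notation. Assembling
  Hessians from such operators makes them bounded operators by construction.\<close>

definition tensor :: "'a::real_inner \<Rightarrow> 'b::real_normed_vector \<Rightarrow> 'a \<Rightarrow>\<^sub>L 'b"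
  where "tensor u b = blinfun_scaleR_left b o\<^sub>L blinfun_inner_right u"

lemma tensor_apply [simp]: "blinfun_apply (tensor u b) v = inner u v *\<^sub>R b"
  by (simp add: tensor_def blinfun_inner_right.rep_eq)

lemma norm_tensor_le: "norm (tensor u b) \<le> norm u * norm b"
proof (rule norm_blinfun_bound)
  show "norm (tensor u b v) \<le> norm u * norm b * norm v" for v
    using mult_right_mono[OF Cauchy_Schwarz_ineq2[of u v], of "norm b"] by (simp add: mult.commute mult.left_commute)
qed simp

lemma bounded_bilinear_tensor: "bounded_bilinear tensor"
proof
  show "\<exists>K. \<forall>a b. norm (tensor a b) \<le> norm a * norm b * K"
    by (rule exI[of _ 1]) (simp add: norm_tensor_le)
qed (auto intro!: blinfun_eqI simp: blinfun.bilinear_simps algebra_simps inner_add_left)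

text \<open>A box suits the Leibniz rule and the shift of integrals; the kernel chosen later is
  supported in a ball of radius at most 1, hence inside it.\<close>

abbreviation unit_box :: "'a::euclidean_space set"
  where "unit_box \<equiv> cbox (-One) One"

text \<open>With the shift placed in \<open>G\<close> and a fixed domain, inequalities for
  \<open>G\<close> pass under the integral for every \<open>x\<close>. The argument is
  \<open>x + y\<close> and not \<open>x - y\<close>, hence the minus sign in the derivative
  below.\<close>

definition mollify :: "('a::euclidean_space \<Rightarrow> real) \<Rightarrow> ('a \<Rightarrow> 'b::euclidean_space) \<Rightarrow> 'a \<Rightarrow> 'b"
  where "mollify k G x = integral unit_box (\<lambda>y. k y *\<^sub>R G (x + y))"

lemma mollify_integrable:
  fixes G :: "'a::euclidean_space \<Rightarrow> 'b::euclidean_space"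
  assumes "continuous_on UNIV k" "continuous_on UNIV G"
  shows "(\<lambda>y. k y *\<^sub>R G (x + y)) integrable_on unit_box"
proof (rule integrable_continuous, rule continuous_on_scaleR)
  show "continuous_on unit_box k"
    using assms(1) continuous_on_subset by blast
  show "continuous_on unit_box (\<lambda>y. G (x + y))"
    by (rule continuous_on_compose2[OF assms(2)]) (auto intro!: continuous_intros)
qed

text \<open>After the substitution \<open>z = x + y\<close> only the kernel depends on
  \<open>x\<close>, so the Leibniz rule differentiates the kernel and \<open>G\<close> need only be
  continuous. In the expansion over \<open>Basis\<close> every coefficient is again a mollification,
  so the lemma can be applied a second time.\<close>

lemma mollify_has_derivative:
  fixes k :: "'a::euclidean_space \<Rightarrow> real" and G :: "'a \<Rightarrow> 'b::euclidean_space"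
  assumes k: "\<And>y. (k has_derivative (\<lambda>v. inner (k' y) v)) (at y)"
    and k': "continuous_on UNIV k'"
    and supp: "\<And>y. y \<notin> unit_box \<Longrightarrow> k y = 0" "\<And>y. y \<notin> unit_box \<Longrightarrow> k' y = 0"
    and G: "continuous_on UNIV G"
  shows "(mollify k G has_derivative
    (\<lambda>v. - (\<Sum>i\<in>Basis. inner i v *\<^sub>R mollify (\<lambda>y. inner (k' y) i) G x0))) (at x0)"
proof -
  \<comment> \<open>This box contains \<open>unit_box\<close> shifted by any \<open>x\<close> within
    distance 1 of \<open>x0\<close>, so near \<open>x0\<close> the domain of integration does not
    depend on \<open>x\<close>.\<close>
  define B :: "'a set" where "B = cbox (x0 - 2 *\<^sub>R One) (x0 + 2 *\<^sub>R One)"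
  define D where "D x z = - tensor (k' (z - x)) (G z)" for x z
  have k_cont: "continuous_on UNIV k"
    using k by (meson continuous_at_imp_continuous_on has_derivative_continuous)
  have shift: "mollify q G x = integral B (\<lambda>z. q (z - x) *\<^sub>R G z)"
    if q: "continuous_on UNIV q" "\<And>y. y \<notin> unit_box \<Longrightarrow> q y = 0" and x: "x \<in> ball x0 1" for q x
  proof -
    have sub: "cbox (x - One) (x + One) \<subseteq> B"
    proof
      fix z assume z: "z \<in> cbox (x - One) (x + One)"
      show "z \<in> B"
        unfolding B_def mem_box
      proof
        fix i :: 'a assume i: "i \<in> Basis"
        have "norm (x - x0) < 1"
          using x by (simp add: dist_norm norm_minus_commute)
        then have "\<bar>inner x i - inner x0 i\<bar> < 1"
          using Basis_le_norm[OF i, of "x - x0"] by (simp add: inner_diff_left)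
        moreover have "inner x i - 1 \<le> inner z i" "inner z i \<le> inner x i + 1"
          using z i by (auto simp: mem_box inner_diff_left inner_add_left)
        ultimately show "inner (x0 - 2 *\<^sub>R One) i \<le> inner z i \<and> inner z i \<le> inner (x0 + 2 *\<^sub>R One) i"
          using i by (simp add: inner_diff_left inner_add_left) linarith
      qed
    qed
    have z: "q (z - x) *\<^sub>R G z = 0" if "z \<notin> cbox (x - One) (x + One)" for z
    proof -
      have "z - x \<notin> unit_box"
        using that by (auto simp: mem_box algebra_simps)
      then show ?thesis
        using q(2) by simp
    qed
    have c: "continuous_on UNIV (\<lambda>z. q (z - x) *\<^sub>R G z)"
      by (intro continuous_on_scaleR G continuous_on_compose2[OF q(1)] continuous_intros) auto
    then have "(\<lambda>z. q (z - x) *\<^sub>R G z) integrable_on cbox (x - One) (x + One)"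
      by (intro integrable_continuous) (blast intro: continuous_on_subset)
    then have "((\<lambda>z. q (z - x) *\<^sub>R G z) has_integral
        integral (cbox (x - One) (x + One)) (\<lambda>z. q (z - x) *\<^sub>R G z)) B"
      by (intro has_integral_on_superset[OF integrable_integral z sub]) auto
    then have "integral B (\<lambda>z. q (z - x) *\<^sub>R G z)
        = integral (cbox (x - One) (x + One)) (\<lambda>z. q (z - x) *\<^sub>R G z)"
      by (rule integral_unique)
    also have "\<dots> = mollify q G x"
      unfolding mollify_def
      by (subst integral_shift_cbox[symmetric, of _ _ _ x]) (simp add: add.commute)
    finally show ?thesis ..
  qed
  have D_cont: "continuous_on S (\<lambda>(x, z). D x z)" for S
    unfolding D_def split_beta
    by (intro continuous_intros bounded_bilinear.continuous_on[OF bounded_bilinear_tensor]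
        continuous_on_compose2[OF k'] continuous_on_compose2[OF G]) auto
  have "((\<lambda>x. integral B (\<lambda>z. k (z - x) *\<^sub>R G z)) has_derivative integral B (D x0))
      (at x0 within ball x0 1)"
    unfolding B_def
  proof (rule leibniz_rule)
    fix x t
    have "((\<lambda>x. k (t - x)) has_derivative (\<lambda>v. inner (k' (t - x)) (- v))) (at x within ball x0 1)"
      by (rule has_derivative_compose[OF _ k, of "\<lambda>x. t - x" "\<lambda>v. - v"])
         (auto intro!: derivative_eq_intros)
    then show "((\<lambda>x. k (t - x) *\<^sub>R G t) has_derivative blinfun_apply (D x t)) (at x within ball x0 1)"
      by (auto simp: D_def blinfun.bilinear_simps intro!: derivative_eq_intros)
  next
    fix x
    have "continuous_on UNIV (\<lambda>z. k (z - x) *\<^sub>R G z)"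
      by (intro continuous_on_scaleR G continuous_on_compose2[OF k_cont] continuous_intros) auto
    then show "(\<lambda>z. k (z - x) *\<^sub>R G z) integrable_on cbox (x0 - 2 *\<^sub>R One) (x0 + 2 *\<^sub>R One)"
      by (intro integrable_continuous) (blast intro: continuous_on_subset)
  qed (auto intro: D_cont)
  then have "((\<lambda>x. integral B (\<lambda>z. k (z - x) *\<^sub>R G z)) has_derivative integral B (D x0)) (at x0)"
    by (simp add: at_within_open[of x0 "ball x0 1"])
  then have der: "(mollify k G has_derivative integral B (D x0)) (at x0)"
    by (rule has_derivative_transform_within_open[where s = "ball x0 1"])
       (auto simp: shift[OF k_cont supp(1)])
  have "integral B (D x0) v = - (\<Sum>i\<in>Basis. inner i v *\<^sub>R mollify (\<lambda>y. inner (k' y) i) G x0)" for v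
  proof -
    have k'i: "continuous_on UNIV (\<lambda>y. inner (k' y) i)" for i
      by (intro continuous_intros k')
    have int: "(\<lambda>z. inner (k' (z - x0)) i *\<^sub>R G z) integrable_on B" for i
      unfolding B_def
      by (intro integrable_continuous continuous_intros continuous_on_compose2[OF k']
          continuous_on_subset[OF G]) auto
    have "D x0 integrable_on B"
      unfolding B_def D_def
      by (intro integrable_continuous continuous_intros bounded_bilinear.continuous_on[OF bounded_bilinear_tensor]
          continuous_on_compose2[OF k'] continuous_on_subset[OF G]) auto
    then have "integral B (D x0) v = integral B (\<lambda>z. D x0 z v)"
      by (rule blinfun_apply_integral)
    also have "\<dots> = integral B (\<lambda>z. - (\<Sum>i\<in>Basis. inner i v *\<^sub>R (inner (k' (z - x0)) i *\<^sub>R G z)))"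
    proof (rule Henstock_Kurzweil_Integration.integral_cong)
      fix z
      have "inner (k' (z - x0)) v = (\<Sum>i\<in>Basis. inner i v * inner (k' (z - x0)) i)"
        by (subst euclidean_inner) (simp only: inner_commute mult.commute)
      then show "D x0 z v = - (\<Sum>i\<in>Basis. inner i v *\<^sub>R (inner (k' (z - x0)) i *\<^sub>R G z))"
        by (simp add: D_def blinfun.bilinear_simps scaleR_sum_left)
    qed
    also have "\<dots> = - (\<Sum>i\<in>Basis. inner i v *\<^sub>R integral B (\<lambda>z. inner (k' (z - x0)) i *\<^sub>R G z))"
      by (simp add: Henstock_Kurzweil_Integration.integral_sum Henstock_Kurzweil_Integration.integrable_cmul
          int del: scaleR_scaleR)
    also have "\<dots> = - (\<Sum>i\<in>Basis. inner i v *\<^sub>R mollify (\<lambda>y. inner (k' y) i) G x0)"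
      using shift[OF k'i] supp(2) by simp
    finally show ?thesis .
  qed
  then show ?thesis
    by (intro has_derivative_eq_rhs[OF der] ext)
qed

section \<open>Powers of the positive part\<close>

text \<open>Away from 0 the function is locally zero or a monomial; at 0 the difference quotient is
  dominated by a positive power of \<open>max 0 h\<close>. Such powers give compactly supported
  bumps of any finite order of smoothness, with explicit polynomial derivatives.\<close>

lemma has_real_derivative_pos_part_power:
  "((\<lambda>v::real. (max 0 v) ^ Suc (Suc n)) has_real_derivative real (Suc (Suc n)) * (max 0 v) ^ Suc n) (at v)"
proof -
  consider "v < 0" | "v > 0" | "v = 0"
    by linarith
  then show ?thesis
  proof cases
    case 1
    have "((\<lambda>_. 0) has_real_derivative 0) (at v)"
      by simp
    then have "((\<lambda>v::real. (max 0 v) ^ Suc (Suc n)) has_real_derivative 0) (at v)"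
      by (rule has_field_derivative_transform_within_open[where S = "{..<0}"]) (use 1 in auto)
    then show ?thesis
      using 1 by simp
  next
    case 2
    have "((\<lambda>v::real. v ^ Suc (Suc n)) has_real_derivative real (Suc (Suc n)) * v ^ Suc n) (at v)"
      using DERIV_pow[of "Suc (Suc n)" v] by simp
    then have "((\<lambda>v::real. (max 0 v) ^ Suc (Suc n)) has_real_derivative real (Suc (Suc n)) * v ^ Suc n) (at v)"
      by (rule has_field_derivative_transform_within_open[where S = "{0<..}"]) (use 2 in auto)
    then show ?thesis
      using 2 by simp
  next
    case 3
    have "((\<lambda>h::real. (max 0 h) ^ Suc (Suc n) / h) \<longlongrightarrow> 0) (at 0)"
    proof (rule Lim_null_comparison)
      show "\<forall>\<^sub>F h in at 0. norm ((max 0 h) ^ Suc (Suc n) / h) \<le> (max 0 h) ^ Suc n"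
        by (rule always_eventually) (auto simp: max_def abs_mult)
      have "((\<lambda>h::real. (max 0 h) ^ Suc n) \<longlongrightarrow> (max 0 0) ^ Suc n) (at 0)"
        by (intro tendsto_intros)
      then show "((\<lambda>h::real. (max 0 h) ^ Suc n) \<longlongrightarrow> 0) (at 0)"
        by simp
    qed
    then show ?thesis
      using 3 by (simp add: DERIV_def)
  qed
qed

lemma has_derivative_pos_part_power:
  assumes "(g has_derivative g') (at x within S)" "2 \<le> n"
  shows "((\<lambda>x. (max 0 (g x :: real)) ^ n) has_derivative
    (\<lambda>v. real n * (max 0 (g x)) ^ (n - 1) * g' v)) (at x within S)"
proof -
  obtain m where "n = Suc (Suc m)"
    using assms(2) by (metis add_2_eq_Suc le_Suc_ex)
  then show ?thesis
    using has_derivative_compose[OF assms(1)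
        has_real_derivative_pos_part_power[of m "g x", unfolded has_field_derivative_def]] by simp
qed

section \<open>Effect of mollification on bounds and Hessians\<close>

text \<open>The remainder of the mollified function is the average of the remainders
  \<open>R y\<close> of its translates. A nonnegative kernel of mass 1 therefore preserves both
  bounds exactly.\<close>

lemma quad_bounds_mollify:
  fixes k :: "'a::euclidean_space \<Rightarrow> real"
  assumes f: "quad_bounds UNIV f G a b"
    and k: "continuous_on UNIV k" "\<And>y. k y \<ge> 0" "integral unit_box k = 1"
  shows "quad_bounds UNIV (mollify k f) (mollify k G) a b"
proof -
  have G: "continuous_on UNIV G"
    using f by (intro quad_bounds_continuous_on) auto
  have fc: "continuous_on UNIV f"
    using quad_bounds_has_derivative[OF f] by (meson UNIV_I continuous_at_imp_continuous_on has_derivative_continuous)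
  note int = mollify_integrable[OF k(1) fc] mollify_integrable[OF k(1) G]
  have kint: "k integrable_on unit_box"
    by (rule integrable_continuous) (blast intro: continuous_on_subset k(1))
  have "a / 2 * (norm (x - z))\<^sup>2 \<le> mollify k f x - mollify k f z - inner (mollify k G z) (x - z)
    \<and> mollify k f x - mollify k f z - inner (mollify k G z) (x - z) \<le> b / 2 * (norm (x - z))\<^sup>2"
    for x z
  proof -
    define R where "R y = f (x + y) - f (z + y) - inner (G (z + y)) (x - z)" for y
    have Gint: "((\<lambda>y. k y * inner (G (z + y)) (x - z)) has_integral inner (mollify k G z) (x - z)) unit_box"
      unfolding mollify_def
      using has_integral_linear[OF integrable_integral[OF int(2)] bounded_linear_inner_left[of "x - z"]]
      by (simp add: o_def)
    have R: "((\<lambda>y. k y * R y) has_integral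
        (mollify k f x - mollify k f z - inner (mollify k G z) (x - z))) unit_box"
      unfolding R_def right_diff_distrib
      by (intro has_integral_diff Gint)
         (use int(1) in \<open>auto simp: mollify_def intro!: integrable_integral\<close>)
    have c: "((\<lambda>y. k y * c) has_integral c) unit_box" for c
      using has_integral_mult_left[OF integrable_integral[OF kint], of c] k(3) by simp
    have "a / 2 * (norm (x - z))\<^sup>2 \<le> R y" "R y \<le> b / 2 * (norm (x - z))\<^sup>2" for y
      using quad_boundsD(1,2)[OF f, of "x + y" "z + y"] by (auto simp: R_def)
    then have "k y * (a / 2 * (norm (x - z))\<^sup>2) \<le> k y * R y" "k y * R y \<le> k y * (b / 2 * (norm (x - z))\<^sup>2)" for y
      by (intro mult_left_mono k(2); blast)+
    then show ?thesis
      using has_integral_le[OF c R] has_integral_le[OF R c] by blast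
  qed
  then show ?thesis
    by (simp add: quad_bounds_def)
qed

text \<open>The absolute value of \<open>q\<close> appears because the lemma serves for partial
  derivatives of the kernel, which change sign.\<close>

lemma mollify_lipschitz:
  fixes G :: "'a::euclidean_space \<Rightarrow> 'b::euclidean_space"
  assumes q: "continuous_on UNIV q" and G: "\<Lambda>-lipschitz_on UNIV G"
  shows "norm (mollify q G x - mollify q G y) \<le> integral unit_box (\<lambda>y. \<bar>q y\<bar>) * \<Lambda> * norm (x - y)"
proof -
  have Gc: "continuous_on UNIV G"
    using G by (rule lipschitz_on_continuous_on)
  have q': "(\<lambda>y. \<bar>q y\<bar>) integrable_on unit_box"
    by (intro integrable_continuous continuous_intros) (blast intro: continuous_on_subset q)
  note int = mollify_integrable[OF q Gc]
  have "mollify q G x - mollify q G y = integral unit_box (\<lambda>t. q t *\<^sub>R G (x + t) - q t *\<^sub>R G (y + t))"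
    unfolding mollify_def by (rule Henstock_Kurzweil_Integration.integral_diff[symmetric]) (rule int)+
  also have "norm \<dots> \<le> integral unit_box (\<lambda>t. \<bar>q t\<bar> * (\<Lambda> * norm (x - y)))"
  proof (rule Henstock_Kurzweil_Integration.integral_norm_bound_integral)
    fix t
    show "norm (q t *\<^sub>R G (x + t) - q t *\<^sub>R G (y + t)) \<le> \<bar>q t\<bar> * (\<Lambda> * norm (x - y))"
      using mult_left_mono[OF lipschitz_on_normD[OF G UNIV_I UNIV_I, of "x + t" "y + t"], of "\<bar>q t\<bar>"]
      by (simp add: scaleR_diff_right[symmetric])
  qed (use int q' in \<open>auto intro!: Henstock_Kurzweil_Integration.integrable_diff integrable_on_mult_left\<close>)
  finally show ?thesis
    by (simp add: mult.assoc)
qed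

lemma mollify_close:
  fixes G :: "'a::euclidean_space \<Rightarrow> 'b::euclidean_space"
  assumes k: "continuous_on UNIV k" "\<And>y. k y \<ge> 0" "integral unit_box k = 1"
    and G: "continuous_on UNIV G" "\<And>y. k y \<noteq> 0 \<Longrightarrow> norm (G (x + y) - G x) \<le> \<delta>"
  shows "norm (mollify k G x - G x) \<le> \<delta>"
proof -
  have kint: "k integrable_on unit_box"
    by (rule integrable_continuous) (blast intro: continuous_on_subset k(1))
  have "((\<lambda>y. k y *\<^sub>R G x) has_integral G x) unit_box"
    using has_integral_scaleR_left[OF integrable_integral[OF kint], of "G x"] k(3) by simp
  then have I: "((\<lambda>y. k y *\<^sub>R G (x + y) - k y *\<^sub>R G x) has_integral (mollify k G x - G x)) unit_box"
    unfolding mollify_def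
    by (intro has_integral_diff integrable_integral mollify_integrable k G)
  have J: "((\<lambda>y. k y * \<delta>) has_integral \<delta>) unit_box"
    using has_integral_mult_left[OF integrable_integral[OF kint], of \<delta>] k(3) by simp
  have "norm (k y *\<^sub>R G (x + y) - k y *\<^sub>R G x) \<le> k y * \<delta>" for y
    using G(2)[of y] k(2)[of y] mult_left_mono[of "norm (G (x + y) - G x)" \<delta> "k y"]
    by (cases "k y = 0") (auto simp: scaleR_diff_right[symmetric])
  then show ?thesis
    using Henstock_Kurzweil_Integration.integral_norm_bound_integral[of
        "\<lambda>y. k y *\<^sub>R G (x + y) - k y *\<^sub>R G x" unit_box "\<lambda>y. k y * \<delta>"] I J
    by (auto simp: integral_unique integrable_on_def k(3))
qed

text \<open>One derivative falls on the kernel, and the Lipschitz property of \<open>G\<close> then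
  bounds the variation of the Hessian. The second derivatives \<open>k''\<close> serve to
  differentiate the Hessian itself, as three times differentiable functions are required.\<close>

lemma lip_hessian_mollify:
  fixes G :: "'a::euclidean_space \<Rightarrow> 'a" and k :: "'a \<Rightarrow> real"
  assumes G: "\<Lambda>-lipschitz_on UNIV G"
    and k: "\<And>y. (k has_derivative (\<lambda>v. inner (k' y) v)) (at y)"
    and k': "continuous_on UNIV k'"
    and supp: "\<And>y. y \<notin> unit_box \<Longrightarrow> k y = 0" "\<And>y. y \<notin> unit_box \<Longrightarrow> k' y = 0"
    and k'': "\<And>i y. ((\<lambda>y. inner (k' y) i) has_derivative (\<lambda>v. inner (k'' i y) v)) (at y)"
      "\<And>i. continuous_on UNIV (k'' i)" "\<And>i y. y \<notin> unit_box \<Longrightarrow> k'' i y = 0"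
  shows "\<exists>\<tau>. lip_hessian UNIV (mollify k G) \<tau>"
proof -
  define P where "P i = mollify (\<lambda>y. inner (k' y) i) G" for i
  define H where "H x = - (\<Sum>i\<in>Basis. tensor i (P i x))" for x
  define C where "C i = integral unit_box (\<lambda>y. \<bar>inner (k' y) i\<bar>) * \<Lambda>" for i
  have k'i: "continuous_on UNIV (\<lambda>y. inner (k' y) i)" for i
    by (intro continuous_intros k')
  have Gc: "continuous_on UNIV G"
    using G by (rule lipschitz_on_continuous_on)
  have "(mollify k G has_derivative H x) (at x)" for x
    using mollify_has_derivative[OF k k' supp Gc, of x]
    by (rule has_derivative_eq_rhs) (auto simp: H_def P_def blinfun.bilinear_simps)
  moreover have "H differentiable_on UNIV"
  proof -
    have "P i differentiable (at x)" for i x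
      unfolding P_def differentiable_def
      using mollify_has_derivative[OF k''(1) k''(2) _ k''(3) Gc, of i x] supp(2) by auto
    then have "(\<lambda>x. tensor i (P i x)) differentiable (at x)" for i x
      using bounded_linear.has_derivative[OF bounded_bilinear.bounded_linear_right[OF bounded_bilinear_tensor, of i]]
      unfolding differentiable_def by blast
    then have "H differentiable (at x)" for x
      unfolding H_def by (intro differentiable_minus differentiable_sum) auto
    then show ?thesis
      by (simp add: differentiable_on_def)
  qed
  moreover have "norm (H z - H w) \<le> (\<Sum>i\<in>Basis. C i) * norm (z - w)" for z w
  proof -
    have "H z - H w = (\<Sum>i\<in>Basis. tensor i (P i w - P i z))"
      by (simp add: H_def bounded_bilinear.diff_right[OF bounded_bilinear_tensor] sum_subtractf)
    also have "norm \<dots> \<le> (\<Sum>i\<in>Basis. C i * norm (z - w))"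
    proof (rule sum_norm_le)
      fix i :: 'a assume "i \<in> Basis"
      then have "norm (tensor i (P i w - P i z)) \<le> norm (P i w - P i z)"
        using norm_tensor_le[of i "P i w - P i z"] by simp
      also have "\<dots> \<le> C i * norm (w - z)"
        unfolding P_def C_def by (rule mollify_lipschitz[OF k'i G])
      finally show "norm (tensor i (P i w - P i z)) \<le> C i * norm (z - w)"
        by (simp add: norm_minus_commute)
    qed
    finally show ?thesis
      by (simp add: sum_distrib_right)
  qed
  ultimately show ?thesis
    unfolding lip_hessian_def by blast
qed

section \<open>The kernel and the smoothing of a function\<close>

lemma notin_unit_box_imp_norm_gt_1: "y \<notin> unit_box \<Longrightarrow> norm y > 1"
  using Basis_le_norm[of _ y] by (force simp: mem_box)

text \<open>A continuous nonnegative function with integral 0 vanishes on the whole box, yet this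
  one is positive at the origin.\<close>

lemma integral_pos_part_ball:
  fixes \<epsilon> :: real
  assumes "\<epsilon> > 0"
  shows "integral (unit_box :: 'a::euclidean_space set) (\<lambda>y. (max 0 (\<epsilon>\<^sup>2 - inner y y)) ^ 3) > 0"
    (is "integral _ ?k > 0")
proof -
  have c: "continuous_on (unit_box :: 'a set) ?k"
    by (intro continuous_intros)
  then have i: "?k integrable_on (unit_box :: 'a set)"
    by (rule integrable_continuous)
  have "integral (unit_box :: 'a set) ?k \<noteq> 0"
  proof
    assume "integral (unit_box :: 'a set) ?k = 0"
    then have "(?k has_integral 0) (unit_box :: 'a set)"
      using i by (metis integrable_integral)
    then have "?k (0::'a) = 0"
      by (intro has_integral_0_cbox_imp_0[OF c]) (auto simp: mem_box box_ne_empty)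
    then show False
      using assms by simp
  qed
  moreover have "integral (unit_box :: 'a set) ?k \<ge> 0"
    by (rule integral_nonneg[OF i]) simp
  ultimately show ?thesis
    by simp
qed

lemma smoothing:
  fixes f :: "'a::euclidean_space \<Rightarrow> real"
  assumes f: "quad_bounds UNIV f G a b" and "\<delta> > 0"
  obtains g H \<tau> where "quad_bounds UNIV g H a b" "lip_hessian UNIV H \<tau>" "\<And>x. norm (H x - G x) \<le> \<delta>"
proof -
  define \<Lambda> where "\<Lambda> = 6 * (\<bar>a\<bar> + \<bar>b\<bar>)"
  have lip: "\<Lambda>-lipschitz_on UNIV G"
    unfolding \<Lambda>_def by (rule quad_bounds_lipschitz[OF _ f]) simp
  have \<Lambda>: "\<Lambda> \<ge> 0"
    using lip by (rule lipschitz_on_nonneg)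
  \<comment> \<open>The bound 1 keeps the support in \<open>unit_box\<close>, and
    \<open>\<Lambda> * \<epsilon> \<le> \<delta>\<close> limits the change of the gradient. Adding 1
    to \<open>\<Lambda>\<close> avoids a zero denominator.\<close>
  define \<epsilon> where "\<epsilon> = min 1 (\<delta> / (\<Lambda> + 1))"
  have \<epsilon>: "0 < \<epsilon>" "\<epsilon> \<le> 1" "\<epsilon> \<le> \<delta> / (\<Lambda> + 1)"
    using \<open>\<delta> > 0\<close> \<Lambda> by (auto simp: \<epsilon>_def)
  have \<epsilon>\<delta>: "\<Lambda> * \<epsilon> \<le> \<delta>"
    using \<epsilon>(1,3) \<Lambda> by (simp add: field_simps)
  \<comment> \<open>The kernel is the normalised cube of \<open>q\<close>: the exponent 3 is the
    least natural one for which two continuous derivatives exist. Below, \<open>k'\<close> is its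
    gradient and \<open>k'' i\<close> the gradient of the component of \<open>k'\<close> along
    \<open>i\<close>.\<close>
  define q where "q y = max 0 (\<epsilon>\<^sup>2 - inner y y)" for y :: 'a
  define c where "c = integral (unit_box :: 'a set) (\<lambda>y. q y ^ 3)"
  define k where "k y = q y ^ 3 / c" for y
  define k' where "k' y = (- (6 / c) * q y ^ 2) *\<^sub>R y" for y
  define k'' where "k'' i y = - (6 / c) *\<^sub>R (((- 4) * q y * inner y i) *\<^sub>R y + q y ^ 2 *\<^sub>R i)" for i y
  have c: "c > 0"
    unfolding c_def q_def using \<epsilon>(1) by (rule integral_pos_part_ball)
  have q0: "q y = 0" if "norm y \<ge> \<epsilon>" for y
    using power_mono[OF that, of 2] \<epsilon>(1) by (simp add: q_def power2_norm_eq_inner)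
  have q_supp: "q y = 0" if "y \<notin> unit_box" for y
    using notin_unit_box_imp_norm_gt_1[OF that] \<epsilon>(2) by (intro q0) simp
  have q_cont: "continuous_on S q" for S
    unfolding q_def by (intro continuous_intros)
  have dq: "((\<lambda>y. \<epsilon>\<^sup>2 - inner y y) has_derivative (\<lambda>v. - 2 * inner y v)) (at y)" for y :: 'a
    by (auto intro!: derivative_eq_intros simp: inner_commute)
  have dq3: "((\<lambda>y. q y ^ 3) has_derivative (\<lambda>v. - 6 * q y ^ 2 * inner y v)) (at y)" for y
    unfolding q_def
    by (rule has_derivative_eq_rhs[OF has_derivative_pos_part_power[OF dq[of y], of 3]]) auto
  have dq2: "((\<lambda>y. q y ^ 2) has_derivative (\<lambda>v. - 4 * q y * inner y v)) (at y)" for y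
    unfolding q_def
    by (rule has_derivative_eq_rhs[OF has_derivative_pos_part_power[OF dq[of y], of 2]]) auto
  have k_cont: "continuous_on UNIV k" and k'_cont: "continuous_on UNIV k'"
    and k''_cont: "continuous_on UNIV (k'' i)" for i
    unfolding k_def k'_def k''_def by (intro continuous_intros q_cont; use c in simp)+
  have k: "(k has_derivative (\<lambda>v. inner (k' y) v)) (at y)" for y
    unfolding k_def divide_inverse mult.commute[of _ "inverse c"]
    by (rule has_derivative_eq_rhs[OF has_derivative_mult_right[OF dq3]]) (simp add: k'_def fun_eq_iff divide_inverse)
  have k'_inner: "inner (k' y) i = - (6 / c) * (q y ^ 2 * inner y i)" for i y
    by (simp add: k'_def)
  have k'': "((\<lambda>y. inner (k' y) i) has_derivative (\<lambda>v. inner (k'' i y) v)) (at y)" for i y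
    unfolding k'_inner
    by (rule has_derivative_eq_rhs[OF has_derivative_mult_right[OF has_derivative_mult[OF dq2
          has_derivative_inner_left[OF has_derivative_ident]]]])
       (simp add: k''_def fun_eq_iff inner_add_left inner_commute algebra_simps)
  have k_nonneg: "k y \<ge> 0" for y
    using c by (simp add: k_def q_def)
  have k_int: "integral unit_box k = 1"
    using c unfolding k_def by (simp add: c_def)
  obtain \<tau> where \<tau>: "lip_hessian UNIV (mollify k G) \<tau>"
    using lip_hessian_mollify[OF lip k k'_cont _ _ k'' k''_cont] q_supp
    by (auto simp: k_def k'_def k''_def)
  have "norm (mollify k G x - G x) \<le> \<delta>" for x
  proof (rule mollify_close[OF k_cont k_nonneg k_int])
    show "continuous_on UNIV G"
      using lip by (rule lipschitz_on_continuous_on)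
    fix y assume "k y \<noteq> 0"
    then have "norm y \<le> \<epsilon>"
      using q0[of y] by (force simp: k_def)
    then have "\<Lambda> * norm y \<le> \<delta>"
      using mult_left_mono[of "norm y" \<epsilon> \<Lambda>] \<Lambda> \<epsilon>\<delta> by linarith
    then show "norm (G (x + y) - G x) \<le> \<delta>"
      using lipschitz_on_normD[OF lip UNIV_I UNIV_I, of "x + y" x] by simp
  qed
  then show thesis
    using that[OF quad_bounds_mollify[OF f k_cont k_nonneg k_int] \<tau>] by blast
qed

section \<open>Correction of gradients at finitely many points\<close>

lemma lip_hessian_zero: "lip_hessian E (\<lambda>_. 0) 0"
  unfolding lip_hessian_def by (intro exI[of _ "\<lambda>_. 0"]) (auto simp: zero_blinfun.rep_eq)

lemma lip_hessian_sum:
  assumes "finite S" "\<And>p. p \<in> S \<Longrightarrow> \<exists>\<tau>. lip_hessian E (G p) \<tau>"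
  shows "\<exists>\<tau>. lip_hessian E (\<lambda>x. \<Sum>p\<in>S. G p x) \<tau>"
  using assms
proof (induction S rule: finite_induct)
  case (insert p S)
  then show ?case
    using lip_hessian_add by (simp add: insert.hyps) blast
qed (use lip_hessian_zero in auto)

lemma quad_bounds_sum:
  assumes "finite S" "subspace E" "\<And>p. p \<in> S \<Longrightarrow> quad_bounds E (f p) (G p) (a p) (b p)"
  shows "quad_bounds E (\<lambda>x. \<Sum>p\<in>S. f p x) (\<lambda>x. \<Sum>p\<in>S. G p x) (\<Sum>p\<in>S. a p) (\<Sum>p\<in>S. b p)"
  using assms(1,3)
proof (induction S rule: finite_induct)
  case empty
  then show ?case
    using subspace_0[OF assms(2)] by (simp add: quad_bounds_def)
next
  case (insert p S)
  then show ?case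
    using quad_bounds_add[OF assms(2), of "f p" "G p" "a p" "b p"] by simp
qed

section \<open>Ridge functions\<close>

text \<open>The problem is one-dimensional along \<open>w\<close>. The mean value theorem bounds the
  remainder by \<open>B * (s - t)^2\<close>; the factor 2 compensates for the halves in
  \<open>quad_bounds\<close>.\<close>

lemma quad_bounds_ridge:
  fixes w p :: "'a::real_inner"
  assumes m: "\<And>s. (m has_real_derivative m' s) (at s)" "\<And>s. (m' has_real_derivative m'' s) (at s)"
    and B: "\<And>s. \<bar>m'' s\<bar> \<le> B"
  shows "quad_bounds UNIV (\<lambda>x. m (inner w (x - p))) (\<lambda>x. m' (inner w (x - p)) *\<^sub>R w)
    (- (2 * B * (norm w)\<^sup>2)) (2 * B * (norm w)\<^sup>2)"
proof -
  have lip: "\<bar>m' s - m' t\<bar> \<le> B * \<bar>s - t\<bar>" for s t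
    using field_differentiable_bound[of UNIV m' m'' B s t] m(2) B by simp
  have B0: "B \<ge> 0"
    using B[of 0] by linarith
  have rem: "\<bar>m s - m t - m' t * (s - t)\<bar> \<le> B * (s - t)\<^sup>2" for s t
  proof (cases "s = t")
    case False
    have "\<exists>z. min s t \<le> z \<and> z \<le> max s t \<and> m s - m t = (s - t) * m' z"
    proof (cases "s < t")
      case True
      then obtain z where "s < z" "z < t" "m t - m s = (t - s) * m' z"
        using MVT2[OF True m(1)] by blast
      then show ?thesis
        by (intro exI[of _ z]) (auto simp: algebra_simps)
    next
      case False
      with \<open>s \<noteq> t\<close> have "t < s"
        by simp
      then obtain z where "t < z" "z < s" "m s - m t = (s - t) * m' z"
        using MVT2[OF _ m(1)] by blast
      then show ?thesis
        by (intro exI[of _ z]) auto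
    qed
    then obtain z where z: "min s t \<le> z" "z \<le> max s t" "m s - m t = (s - t) * m' z"
      by blast
    have "\<bar>m' z - m' t\<bar> \<le> B * \<bar>s - t\<bar>"
      using lip[of z t] mult_left_mono[of "\<bar>z - t\<bar>" "\<bar>s - t\<bar>" B] B0 z(1,2) by linarith
    then have "\<bar>m' z - m' t\<bar> * \<bar>s - t\<bar> \<le> B * \<bar>s - t\<bar> * \<bar>s - t\<bar>"
      by (rule mult_right_mono) simp
    moreover have "m s - m t - m' t * (s - t) = (m' z - m' t) * (s - t)"
      by (simp add: z(3) algebra_simps)
    ultimately show ?thesis
      by (simp add: abs_mult power2_eq_square mult.assoc)
  qed simp
  have "\<bar>m (inner w (x - p)) - m (inner w (y - p)) - inner (m' (inner w (y - p)) *\<^sub>R w) (x - y)\<bar>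
      \<le> B * (norm w)\<^sup>2 * (norm (x - y))\<^sup>2" for x y
  proof -
    have "inner w (x - p) - inner w (y - p) = inner w (x - y)"
      by (simp add: inner_diff_right)
    moreover have "(inner w (x - y))\<^sup>2 \<le> (norm w)\<^sup>2 * (norm (x - y))\<^sup>2"
      using Cauchy_Schwarz_ineq[of w "x - y"] by (simp add: power2_norm_eq_inner)
    then have "B * (inner w (x - y))\<^sup>2 \<le> B * ((norm w)\<^sup>2 * (norm (x - y))\<^sup>2)"
      using B0 by (rule mult_left_mono)
    ultimately show ?thesis
      using rem[of "inner w (x - p)" "inner w (y - p)"] by (simp add: mult.assoc)
  qed
  then show ?thesis
    unfolding quad_bounds_def abs_le_iff by (simp add: algebra_simps)
qed

text \<open>The Hessian is \<open>m''\<close> times the fixed operator \<open>tensor w w\<close>, so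
  a bound on \<open>m'''\<close> controls its variation.\<close>

lemma lip_hessian_ridge:
  fixes w p :: "'a::real_inner"
  assumes m: "\<And>s. (m' has_real_derivative m'' s) (at s)" "\<And>s. (m'' has_real_derivative m''' s) (at s)"
    and B: "\<And>s. \<bar>m''' s\<bar> \<le> B"
  shows "\<exists>\<tau>. lip_hessian UNIV (\<lambda>x. m' (inner w (x - p)) *\<^sub>R w) \<tau>"
proof -
  define H where "H x = m'' (inner w (x - p)) *\<^sub>R tensor w w" for x
  have lip: "\<bar>m'' s - m'' t\<bar> \<le> B * \<bar>s - t\<bar>" for s t
    using field_differentiable_bound[of UNIV m'' m''' B s t] m(2) B by simp
  have B0: "B \<ge> 0"
    using B[of 0] by linarith
  have inn: "((\<lambda>x. inner w (x - p)) has_derivative (\<lambda>v. inner w v)) (at x)" for x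
    by (auto intro!: derivative_eq_intros)
  have "((\<lambda>x. m' (inner w (x - p)) *\<^sub>R w) has_derivative H x) (at x)" for x
    using has_derivative_scaleR_left[OF has_derivative_compose[OF inn m(1)[unfolded has_field_derivative_def]], of w x]
    by (rule has_derivative_eq_rhs) (simp add: H_def fun_eq_iff scaleR_blinfun.rep_eq)
  moreover have "H differentiable (at x)" for x
    unfolding H_def differentiable_def
    using has_derivative_scaleR_left[OF has_derivative_compose[OF inn m(2)[unfolded has_field_derivative_def]], of "tensor w w" x]
    by blast
  moreover have "norm (H x - H y) \<le> B * norm w * norm (tensor w w) * norm (x - y)" for x y
  proof -
    have "\<bar>m'' (inner w (x - p)) - m'' (inner w (y - p))\<bar> \<le> B * \<bar>inner w (x - y)\<bar>"
      using lip[of "inner w (x - p)" "inner w (y - p)"] by (simp add: inner_diff_right)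
    also have "\<dots> \<le> B * (norm w * norm (x - y))"
      by (intro mult_left_mono Cauchy_Schwarz_ineq2 B0)
    finally have "\<bar>m'' (inner w (x - p)) - m'' (inner w (y - p))\<bar> * norm (tensor w w)
        \<le> B * (norm w * norm (x - y)) * norm (tensor w w)"
      by (rule mult_right_mono) simp
    then show ?thesis
      by (simp add: H_def scaleR_diff_left[symmetric] mult_ac)
  qed
  ultimately show ?thesis
    unfolding lip_hessian_def differentiable_on_def by blast
qed

text \<open>The profile is \<open>s * (1 - (s / r)^2)^4\<close>, cut off to 0 for
  \<open>\<bar>s\<bar> \<ge> r\<close>. The factor \<open>s\<close> gives slope 1 at the origin, and
  the fourth power makes the cut-off three times differentiable.\<close>

lemma C3_profile_exists:
  fixes r :: real
  assumes r: "r > 0"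
  obtains m m' m'' m''' :: "real \<Rightarrow> real" and B where
    "\<And>s. (m has_real_derivative m' s) (at s)" "\<And>s. (m' has_real_derivative m'' s) (at s)"
    "\<And>s. (m'' has_real_derivative m''' s) (at s)" "\<And>s. \<bar>m'' s\<bar> \<le> B" "\<And>s. \<bar>m''' s\<bar> \<le> B"
    "m' 0 = 1" "\<And>s. \<bar>s\<bar> \<ge> r \<Longrightarrow> m' s = 0"
proof -
  define P where "P s = max 0 (1 - (s / r)\<^sup>2)" for s
  \<comment> \<open>The span of these monomials is closed under differentiation as long as the power
    of \<open>P\<close> is at least 2. Up to powers of \<open>r\<close>, the functions
    \<open>M1\<close>, \<open>M2\<close>, \<open>M3\<close> are the first three derivatives of the
    profile.\<close>
  define T where "T i n s = (s / r) ^ i * P s ^ n" for i n s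
  define M1 where "M1 s = T 0 4 s - 8 * T 2 3 s" for s
  define M2 where "M2 s = - 24 * T 1 3 s + 48 * T 3 2 s" for s
  define M3 where "M3 s = - 24 * T 0 3 s + 288 * T 2 2 s - 192 * T 4 1 s" for s
  have P01: "0 \<le> P s" "P s \<le> 1" for s
    by (auto simp: P_def)
  have P0: "P s = 0" if "\<bar>s\<bar> \<ge> r" for s
  proof -
    have "1 \<le> \<bar>s / r\<bar>"
      using that r by simp
    then have "1 \<le> (s / r)\<^sup>2"
      using power_mono[of 1 "\<bar>s / r\<bar>" 2] unfolding power2_abs by simp
    then show ?thesis
      by (simp add: P_def)
  qed
  have d: "((\<lambda>s. 1 - (s / r)\<^sup>2) has_derivative (\<lambda>v. - (2 * (s / r) / r) * v)) (at s)" for s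
    using r by (auto intro!: derivative_eq_intros)
  have dP: "((\<lambda>s. P s ^ n) has_real_derivative
      real n * P s ^ (n - 1) * (- (2 * (s / r) / r))) (at s)" if "2 \<le> n" for s n
    unfolding has_field_derivative_def P_def
    by (rule has_derivative_eq_rhs[OF has_derivative_pos_part_power[OF d[of s] that]])
       (simp add: fun_eq_iff mult.assoc)
  have dS: "((\<lambda>s. (s / r) ^ i) has_real_derivative real i * (s / r) ^ (i - 1) / r) (at s)" for s i
    by (rule DERIV_cong[OF DERIV_power[OF DERIV_cdivide[OF DERIV_ident]]]) simp
  \<comment> \<open>For \<open>i = 0\<close> the truncated \<open>i - 1\<close> is harmless, as its
    term has coefficient 0.\<close>
  have dT: "(T i n has_real_derivative (real i * T (i - 1) n s - 2 * real n * T (i + 1) (n - 1) s) / r) (at s)"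
    if "2 \<le> n" for s i n
    unfolding T_def
    by (rule DERIV_cong[OF DERIV_mult[OF dS dP[OF that]]]) (use r in \<open>simp add: field_simps\<close>)
  have "((\<lambda>s. s * P s ^ 4) has_real_derivative M1 s) (at s)" for s
    by (rule DERIV_cong[OF DERIV_mult[OF DERIV_ident dP]])
       (use r in \<open>simp_all add: M1_def T_def power2_eq_square field_simps\<close>)
  moreover have "(M1 has_real_derivative M2 s / r) (at s)" for s
    unfolding M1_def
    by (rule DERIV_cong[OF DERIV_diff[OF dT DERIV_cmult[OF dT]]])
       (use r in \<open>simp_all add: M2_def field_simps eval_nat_numeral\<close>)
  moreover have "((\<lambda>s. M2 s / r) has_real_derivative M3 s / r\<^sup>2) (at s)" for s
    unfolding M2_def
    by (rule DERIV_cong[OF DERIV_cdivide[OF DERIV_add[OF DERIV_cmult[OF dT] DERIV_cmult[OF dT]]]])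
       (use r in \<open>simp_all add: M3_def field_simps eval_nat_numeral\<close>)
  moreover have "\<bar>M2 s / r\<bar> \<le> 504 / r + 504 / r\<^sup>2" "\<bar>M3 s / r\<^sup>2\<bar> \<le> 504 / r + 504 / r\<^sup>2" for s
  proof -
    have bd: "\<bar>T i n s\<bar> \<le> 1" if "n > 0" for i n
    proof (cases "\<bar>s\<bar> \<ge> r")
      case False
      then have "\<bar>s / r\<bar> \<le> 1"
        using r by simp
      then have "\<bar>s / r\<bar> ^ i \<le> 1" "P s ^ n \<le> 1"
        using P01 by (auto intro!: power_le_one)
      then show ?thesis
        using P01 by (auto simp: T_def abs_mult power_abs intro!: mult_le_one)
    qed (use that in \<open>simp add: T_def P0 zero_power\<close>)
    \<comment> \<open>Every monomial involved is at most 1 in absolute value, and 504 = 24 + 288 +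
      192 is the sum of the coefficients in \<open>M3\<close>; those in \<open>M2\<close> add up to
      72.\<close>
    have "\<bar>M2 s\<bar> \<le> 504" "\<bar>M3 s\<bar> \<le> 504"
      using bd[of 3 1] bd[of 2 3] bd[of 3 0] bd[of 2 2] bd[of 1 4] unfolding M2_def M3_def by linarith+
    then have "\<bar>M2 s\<bar> / r \<le> 504 / r" "\<bar>M3 s\<bar> / r\<^sup>2 \<le> 504 / r\<^sup>2"
      using r by (auto intro: divide_right_mono)
    then show "\<bar>M2 s / r\<bar> \<le> 504 / r + 504 / r\<^sup>2" "\<bar>M3 s / r\<^sup>2\<bar> \<le> 504 / r + 504 / r\<^sup>2"
      using r by (simp_all add: add_increasing add_increasing2)
  qed
  moreover have "M1 0 = 1" "\<And>s. \<bar>s\<bar> \<ge> r \<Longrightarrow> M1 s = 0"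
    by (auto simp: M1_def T_def P0) (simp add: P_def)
  ultimately show thesis
    using that[of "\<lambda>s. s * P s ^ 4" M1 "\<lambda>s. M2 s / r" "\<lambda>s. M3 s / r\<^sup>2"] by blast
qed

section \<open>Prescribing small gradients at finitely many points\<close>

text \<open>Each pair of distinct points excludes at most one slope \<open>u\<close>, so only
  finitely many slopes are bad. The set \<open>F\<close> allows a second direction independent of
  the first.\<close>

lemma separating_direction:
  fixes S :: "(real^2) set"
  assumes "finite S" "finite F"
  shows "\<exists>u. u \<notin> F \<and> (\<forall>p\<in>S. \<forall>q\<in>S. p \<noteq> q \<longrightarrow> inner (vector [1, u]) (p - q) \<noteq> 0)"
proof -
  \<comment> \<open>If the second coordinates agree, the quotient is 0 by convention. This only
    excludes one more slope: for such distinct points the inner product is a nonzero difference of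
    first coordinates.\<close>
  define Z where "Z = (\<lambda>(p, q). - (p $ 1 - q $ 1) / (p $ 2 - q $ 2)) ` (S \<times> S)"
  have "finite (F \<union> Z)"
    using assms by (simp add: Z_def)
  then obtain u where u: "u \<notin> F \<union> Z"
    using ex_new_if_finite infinite_UNIV_char_0 by blast
  have "inner (vector [1, u]) (p - q) \<noteq> 0" if "p \<in> S" "q \<in> S" "p \<noteq> q" for p q :: "real^2"
  proof
    assume "inner (vector [1, u]) (p - q) = 0"
    then have eq: "(p $ 1 - q $ 1) + u * (p $ 2 - q $ 2) = 0"
      by (simp add: inner_vec_def sum_2)
    show False
    proof (cases "p $ 2 = q $ 2")
      case True
      then show False
        using eq that(3) by (simp add: vec_eq_iff forall_2)
    next
      case False
      then have "u = - (p $ 1 - q $ 1) / (p $ 2 - q $ 2)"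
        using eq by (simp add: field_simps)
      then have "u \<in> Z"
        using that unfolding Z_def by (intro image_eqI[of _ _ "(p, q)"]) auto
      then show False
        using u by blast
    qed
  qed
  then show ?thesis
    using u by blast
qed

text \<open>Each \<open>e p\<close> is split along two independent directions that separate
  \<open>S\<close>, and each part is realised by a ridge function centred at \<open>p\<close>. The
  ridges are so narrow that their gradients vanish at all other points of \<open>S\<close>, hence
  they add up without interference. That \<open>C\<close> depends on \<open>S\<close> only lets the
  accuracy \<open>\<delta>\<close> be chosen after it.\<close>

lemma gradient_correction:
  fixes S :: "(real^2) set"
  assumes S: "finite S"
  obtains C where "C > 0" and "\<And>e \<delta>. \<lbrakk>\<And>p. p \<in> S \<Longrightarrow> norm (e p) \<le> \<delta>; 0 \<le> \<delta>\<rbrakk> \<Longrightarrow>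
    \<exists>\<psi> \<Psi> \<tau>. quad_bounds UNIV \<psi> \<Psi> (- (C * \<delta>)) (C * \<delta>) \<and> lip_hessian UNIV \<Psi> \<tau> \<and> (\<forall>p\<in>S. \<Psi> p = e p)"
proof -
  obtain u where u: "\<forall>p\<in>S. \<forall>q\<in>S. p \<noteq> q \<longrightarrow> inner (vector [1, u]) (p - q) \<noteq> 0"
    using separating_direction[OF S finite.emptyI] by metis
  obtain v where v: "v \<notin> {u}" "\<forall>p\<in>S. \<forall>q\<in>S. p \<noteq> q \<longrightarrow> inner (vector [1, v]) (p - q) \<noteq> 0"
    using separating_direction[OF S finite.insertI[OF finite.emptyI]] by metis
  define w where "w = (vector [1, u] :: real^2)"
  define z where "z = (vector [1, v] :: real^2)"
  \<comment> \<open>The inserted 1 keeps the minimum defined when \<open>S\<close> has no two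
    distinct points.\<close>
  define r where "r = Min (insert 1 ((\<lambda>(p, q). min \<bar>inner w (p - q)\<bar> \<bar>inner z (p - q)\<bar>) `
    {(p, q) \<in> S \<times> S. p \<noteq> q}))"
  have fin: "finite {(p, q) \<in> S \<times> S. p \<noteq> q}"
    by (rule finite_subset[of _ "S \<times> S"]) (use S in auto)
  have r: "r > 0"
    unfolding r_def using fin u v by (subst Min_gr_iff) (auto simp: w_def z_def)
  have sep: "r \<le> \<bar>inner w (p - q)\<bar>" "r \<le> \<bar>inner z (p - q)\<bar>" if "p \<in> S" "q \<in> S" "p \<noteq> q" for p q
  proof -
    have "r \<le> min \<bar>inner w (p - q)\<bar> \<bar>inner z (p - q)\<bar>"
      unfolding r_def using that fin by (intro Min_le) force+
    then show "r \<le> \<bar>inner w (p - q)\<bar>" "r \<le> \<bar>inner z (p - q)\<bar>"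
      by auto
  qed
  obtain m m' m'' m''' :: "real \<Rightarrow> real" and B where
    m: "\<And>s. (m has_real_derivative m' s) (at s)" "\<And>s. (m' has_real_derivative m'' s) (at s)"
    "\<And>s. (m'' has_real_derivative m''' s) (at s)" "\<And>s. \<bar>m'' s\<bar> \<le> B" "\<And>s. \<bar>m''' s\<bar> \<le> B"
    "m' 0 = 1" "\<And>s. \<bar>s\<bar> \<ge> r \<Longrightarrow> m' s = 0"
    using C3_profile_exists[OF r] by metis
  have B: "B \<ge> 0"
    using m(4)[of 0] by linarith
  \<comment> \<open>Cramer's rule gives \<open>\<bar>b p\<bar> \<le> (1 + \<bar>u\<bar>) * \<delta>
    / \<bar>v - u\<bar>\<close>; the summand 1 accounts for
    \<open>a p = e p $ 1 - b p\<close>.\<close>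
  define A where "A = 1 + (1 + \<bar>u\<bar>) / \<bar>v - u\<bar>"
  have A: "A \<ge> 0"
    by (simp add: A_def)
  define c where "c = 2 * (A * B) * ((norm w)\<^sup>2 + (norm z)\<^sup>2)"
  \<comment> \<open>One is added so that \<open>C\<close> is positive even if \<open>S\<close> is
    empty, since it becomes a denominator.\<close>
  define C where "C = card S * c + 1"
  have c: "c \<ge> 0"
    using A B by (simp add: c_def)
  have "\<exists>\<psi> \<Psi> \<tau>. quad_bounds UNIV \<psi> \<Psi> (- (C * \<delta>)) (C * \<delta>) \<and> lip_hessian UNIV \<Psi> \<tau> \<and> (\<forall>p\<in>S. \<Psi> p = e p)"
    if e: "\<And>p. p \<in> S \<Longrightarrow> norm (e p) \<le> \<delta>" and \<delta>: "0 \<le> \<delta>" for e \<delta>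
  proof -
    \<comment> \<open>Solution of \<open>a + b = e p $ 1\<close> and
      \<open>a * u + b * v = e p $ 2\<close>.\<close>
    define b where "b p = (e p $ 2 - u * e p $ 1) / (v - u)" for p
    define a where "a p = e p $ 1 - b p" for p
    have eq: "a p *\<^sub>R w + b p *\<^sub>R z = e p" for p
    proof -
      have "b p * (v - u) = e p $ 2 - u * e p $ 1"
        using v(1) by (simp add: b_def)
      then show ?thesis
        by (simp add: vec_eq_iff forall_2 w_def z_def a_def algebra_simps)
    qed
    have ab: "\<bar>a p\<bar> \<le> A * \<delta>" "\<bar>b p\<bar> \<le> A * \<delta>" if "p \<in> S" for p
    proof -
      have e12: "\<bar>e p $ 1\<bar> \<le> \<delta>" "\<bar>e p $ 2\<bar> \<le> \<delta>"
        using e[OF that] component_le_norm_cart[of "e p"] order_trans by blast+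
      have "\<bar>e p $ 2 - u * e p $ 1\<bar> \<le> \<bar>e p $ 2\<bar> + \<bar>u\<bar> * \<bar>e p $ 1\<bar>"
        using abs_triangle_ineq4[of "e p $ 2" "u * e p $ 1"] by (simp add: abs_mult)
      also have "\<dots> \<le> \<delta> + \<bar>u\<bar> * \<delta>"
        using e12 by (intro add_mono mult_left_mono) auto
      finally have "\<bar>b p\<bar> \<le> (\<delta> + \<bar>u\<bar> * \<delta>) / \<bar>v - u\<bar>"
        unfolding b_def abs_divide by (intro divide_right_mono) auto
      also have "\<dots> = (A - 1) * \<delta>"
        by (simp add: A_def algebra_simps add_divide_distrib)
      finally have "\<bar>b p\<bar> \<le> A * \<delta> - \<delta>"
        by (simp add: algebra_simps)
      then show "\<bar>a p\<bar> \<le> A * \<delta>" "\<bar>b p\<bar> \<le> A * \<delta>"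
        using e12(1) \<delta> by (auto simp: a_def)
    qed
    define f where "f p x = a p * m (inner w (x - p)) + b p * m (inner z (x - p))" for p x
    define G where "G p x = (a p * m' (inner w (x - p))) *\<^sub>R w + (b p * m' (inner z (x - p))) *\<^sub>R z" for p x
    have bound: "\<bar>k * t\<bar> \<le> A * \<delta> * B" if "\<bar>k\<bar> \<le> A * \<delta>" "\<bar>t\<bar> \<le> B" for k t
      unfolding abs_mult using that A \<delta> B by (intro mult_mono) auto
    have fG: "quad_bounds UNIV (f p) (G p) (- (c * \<delta>)) (c * \<delta>)" if "p \<in> S" for p
    proof -
      have "quad_bounds UNIV (\<lambda>x. a p * m (inner w (x - p))) (\<lambda>x. (a p * m' (inner w (x - p))) *\<^sub>R w)
          (- (2 * (A * \<delta> * B) * (norm w)\<^sup>2)) (2 * (A * \<delta> * B) * (norm w)\<^sup>2)"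
        by (rule quad_bounds_ridge[OF DERIV_cmult[OF m(1)] DERIV_cmult[OF m(2)] bound[OF ab(1)[OF that] m(4)]])
      moreover have "quad_bounds UNIV (\<lambda>x. b p * m (inner z (x - p))) (\<lambda>x. (b p * m' (inner z (x - p))) *\<^sub>R z)
          (- (2 * (A * \<delta> * B) * (norm z)\<^sup>2)) (2 * (A * \<delta> * B) * (norm z)\<^sup>2)"
        by (rule quad_bounds_ridge[OF DERIV_cmult[OF m(1)] DERIV_cmult[OF m(2)] bound[OF ab(2)[OF that] m(4)]])
      ultimately show ?thesis
        unfolding f_def G_def
        by (intro quad_bounds_mono[OF quad_bounds_add]) (auto simp: c_def algebra_simps)
    qed
    have GL: "\<exists>\<tau>. lip_hessian UNIV (G p) \<tau>" if p: "p \<in> S" for p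
    proof -
      have "\<exists>\<sigma>. lip_hessian UNIV (\<lambda>x. (a p * m' (inner w (x - p))) *\<^sub>R w) \<sigma>"
        by (rule lip_hessian_ridge[OF DERIV_cmult[OF m(2)] DERIV_cmult[OF m(3)] bound[OF ab(1)[OF p] m(5)]])
      moreover have "\<exists>\<tau>. lip_hessian UNIV (\<lambda>x. (b p * m' (inner z (x - p))) *\<^sub>R z) \<tau>"
        by (rule lip_hessian_ridge[OF DERIV_cmult[OF m(2)] DERIV_cmult[OF m(3)] bound[OF ab(2)[OF p] m(5)]])
      ultimately show ?thesis
        unfolding G_def using lip_hessian_add by blast
    qed
    have interp: "(\<Sum>p\<in>S. G p q) = e q" if q: "q \<in> S" for q
    proof -
      have "G p q = (if q = p then e q else 0)" if "p \<in> S" for p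
        using m(6) m(7) sep[OF q that] eq[of q] by (auto simp: G_def)
      then show ?thesis
        using S q by simp
    qed
    have "quad_bounds UNIV (\<lambda>x. \<Sum>p\<in>S. f p x) (\<lambda>x. \<Sum>p\<in>S. G p x) (- (C * \<delta>)) (C * \<delta>)"
      using quad_bounds_sum[OF S subspace_UNIV fG]
      by (rule quad_bounds_mono) (use \<delta> in \<open>auto simp: C_def algebra_simps\<close>)
    moreover have "\<exists>\<tau>. lip_hessian UNIV (\<lambda>x. \<Sum>p\<in>S. G p x) \<tau>"
      by (rule lip_hessian_sum[OF S GL])
    ultimately show ?thesis
      using interp by blast
  qed
  then show thesis
    using that[of C] c by (simp add: C_def add_nonneg_pos)
qed

lemma smooth_interpolation:
  fixes S :: "(real^2) set"
  assumes h: "quad_bounds UNIV h G a b" and "\<mu> < a" "b < L" and S: "finite S"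
  obtains \<phi> \<Phi> \<tau> where "\<tau> > 0" "quad_bounds UNIV \<phi> \<Phi> \<mu> L" "lip_hessian UNIV \<Phi> \<tau>" "\<And>p. p \<in> S \<Longrightarrow> \<Phi> p = G p"
proof -
  obtain C where C: "C > 0" and corr: "\<And>e \<delta>. \<lbrakk>\<And>p. p \<in> S \<Longrightarrow> norm (e p) \<le> \<delta>; 0 \<le> \<delta>\<rbrakk> \<Longrightarrow>
    \<exists>\<psi> \<Psi> \<tau>. quad_bounds UNIV \<psi> \<Psi> (- (C * \<delta>)) (C * \<delta>) \<and> lip_hessian UNIV \<Psi> \<tau> \<and> (\<forall>p\<in>S. \<Psi> p = e p)"
    using gradient_correction[OF S] by metis
  \<comment> \<open>The mollification error is at most \<open>\<delta>\<close>, so correcting it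
    costs at most \<open>C * \<delta>\<close>, which fits into the gap on either side.\<close>
  define \<delta> where "\<delta> = min (a - \<mu>) (L - b) / C"
  have \<delta>: "\<delta> > 0" "C * \<delta> \<le> a - \<mu>" "C * \<delta> \<le> L - b"
    using C assms by (auto simp: \<delta>_def)
  obtain g H \<sigma> where g: "quad_bounds UNIV g H a b" "lip_hessian UNIV H \<sigma>" "\<And>x. norm (H x - G x) \<le> \<delta>"
    using smoothing[OF h \<delta>(1)] by metis
  obtain \<psi> \<Psi> \<tau> where \<psi>: "quad_bounds UNIV \<psi> \<Psi> (- (C * \<delta>)) (C * \<delta>)" "lip_hessian UNIV \<Psi> \<tau>"
    "\<forall>p\<in>S. \<Psi> p = G p - H p"
    using corr[of "\<lambda>p. G p - H p" \<delta>] g(3) \<delta>(1) by (auto simp: norm_minus_commute)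
  obtain J where J: "\<And>x. ((\<lambda>x. H x + \<Psi> x) has_derivative blinfun_apply (J x)) (at x)"
    "J differentiable_on UNIV" "\<And>z w. norm (J z - J w) \<le> (\<sigma> + \<tau>) * norm (z - w)"
    using lip_hessian_add[OF g(2) \<psi>(2)] unfolding lip_hessian_def by auto
  \<comment> \<open>The maximum with 1 only ensures that the constant is positive.\<close>
  have "norm (J z - J w) \<le> max 1 (\<sigma> + \<tau>) * norm (z - w)" for z w
    using J(3)[of z w] mult_right_mono[of "\<sigma> + \<tau>" "max 1 (\<sigma> + \<tau>)" "norm (z - w)"] by simp
  then have "lip_hessian UNIV (\<lambda>x. H x + \<Psi> x) (max 1 (\<sigma> + \<tau>))"
    using J unfolding lip_hessian_def by blast
  moreover have "quad_bounds UNIV (\<lambda>x. g x + \<psi> x) (\<lambda>x. H x + \<Psi> x) \<mu> L"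
    using quad_bounds_add[OF subspace_UNIV g(1) \<psi>(1)] by (rule quad_bounds_mono) (use \<delta> in auto)
  ultimately show thesis
    using that[of "max 1 (\<sigma> + \<tau>)" "\<lambda>x. g x + \<psi> x" "\<lambda>x. H x + \<Psi> x"] \<psi>(3) by simp
qed

section \<open>Rescaling and transfer to sequences\<close>

definition plane :: "fin_seq \<Rightarrow> real^2"
  where "plane x = vector [coord x 0, coord x 1]"

definition embed :: "real^2 \<Rightarrow> fin_seq"
  where "embed v = Abs_fin_seq (\<lambda>i. if i = 0 then v $ 1 else if i = 1 then v $ 2 else 0)"

lemma coord_embed: "coord (embed v) i = (if i = 0 then v $ 1 else if i = 1 then v $ 2 else 0)"
  unfolding embed_def
  by (subst Abs_fin_seq_inverse) (auto intro: finite_subset[of _ "{0, 1}"])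

lemma embed_in_Rd [simp]: "embed v \<in> Rd 2"
  by (simp add: Rd_def coord_embed)

lemma plane_embed [simp]: "plane (embed v) = v"
  by (simp add: plane_def coord_embed vec_eq_iff forall_2)

lemma embed_plane: "x \<in> Rd 2 \<Longrightarrow> embed (plane x) = x"
  by (rule fin_seq_eqI) (auto simp: plane_def coord_embed Rd_def)

text \<open>\<open>embed\<close> is the adjoint of \<open>plane\<close>; it therefore carries
  gradients in the plane to gradients within \<open>Rd 2\<close>.\<close>

lemma inner_embed: "inner (embed v) y = inner v (plane y)"
proof -
  have "inner (embed v) y = (\<Sum>i<2. coord (embed v) i * coord y i)"
    by (rule inner_Rd) simp
  then show ?thesis
    by (simp add: coord_embed plane_def inner_vec_def sum_2 eval_nat_numeral)
qed

lemma linear_plane: "linear plane"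
  by (rule linearI) (simp_all add: plane_def vec_eq_iff forall_2)

lemma linear_embed: "linear embed"
  by (rule linearI) (auto intro!: fin_seq_eqI simp: coord_embed algebra_simps)

lemma norm_embed [simp]: "norm (embed v) = norm v"
  by (simp add: norm_eq_sqrt_inner inner_embed)

lemma norm_plane_le: "norm (plane x) \<le> norm x"
proof -
  have "(norm (plane x))\<^sup>2 = inner (embed (plane x)) x"
    by (simp add: inner_embed power2_norm_eq_inner)
  also have "\<dots> \<le> norm (plane x) * norm x"
    using norm_cauchy_schwarz[of "embed (plane x)" x] by simp
  finally show ?thesis
    by (cases "norm (plane x) = 0") (simp_all add: power2_eq_square)
qed

lemma bounded_linear_plane: "bounded_linear plane"
  using linear_plane norm_plane_le
  by (intro bounded_linear_intro[of _ 1]) (auto simp: linear_add linear_scale)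

lemma bounded_linear_embed: "bounded_linear embed"
  using linear_embed by (intro bounded_linear_intro[of _ 1]) (auto simp: linear_add linear_scale)

lemma norm_plane: "x \<in> Rd 2 \<Longrightarrow> norm (plane x) = norm x"
  using norm_embed[of "plane x"] by (simp add: embed_plane)

text \<open>The factor \<open>\<rho>^2\<close> cancels the squared dilation of lengths. Gradients
  scale by \<open>\<rho>\<close> like the points, which leaves the heavy-ball recursion
  invariant.\<close>

lemma quad_bounds_rescale:
  assumes f: "quad_bounds UNIV f G a b" and "\<rho> > 0"
  shows "quad_bounds (Rd 2) (\<lambda>x. \<rho>\<^sup>2 * f (plane x /\<^sub>R \<rho>)) (\<lambda>x. \<rho> *\<^sub>R embed (G (plane x /\<^sub>R \<rho>))) a b"
  unfolding quad_bounds_def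
proof (intro conjI ballI)
  fix x assume "x \<in> Rd 2"
  then show "\<rho> *\<^sub>R embed (G (plane x /\<^sub>R \<rho>)) \<in> Rd 2"
    by (intro subspace_scale subspace_Rd embed_in_Rd)
next
  fix x y assume xy: "x \<in> Rd 2" "y \<in> Rd 2"
  let ?x = "plane x /\<^sub>R \<rho>" and ?y = "plane y /\<^sub>R \<rho>"
  have d: "?x - ?y = plane (x - y) /\<^sub>R \<rho>"
    by (simp add: linear_diff[OF linear_plane] scaleR_diff_right)
  have n: "\<rho>\<^sup>2 * (norm (?x - ?y))\<^sup>2 = (norm (x - y))\<^sup>2"
    unfolding d using norm_plane[OF subspace_diff[OF subspace_Rd xy]] \<open>\<rho> > 0\<close>
    by (simp add: power_mult_distrib field_simps)
  have i: "\<rho>\<^sup>2 * inner (G ?y) (?x - ?y) = inner (\<rho> *\<^sub>R embed (G ?y)) (x - y)"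
    unfolding d using \<open>\<rho> > 0\<close> by (simp add: inner_embed power2_eq_square)
  have "\<rho>\<^sup>2 * (a / 2 * (norm (?x - ?y))\<^sup>2) \<le> \<rho>\<^sup>2 * (f ?x - f ?y - inner (G ?y) (?x - ?y))"
    "\<rho>\<^sup>2 * (f ?x - f ?y - inner (G ?y) (?x - ?y)) \<le> \<rho>\<^sup>2 * (b / 2 * (norm (?x - ?y))\<^sup>2)"
    by (intro mult_left_mono quad_boundsD[OF f]; simp)+
  then have "a / 2 * (\<rho>\<^sup>2 * (norm (?x - ?y))\<^sup>2) \<le> \<rho>\<^sup>2 * f ?x - \<rho>\<^sup>2 * f ?y - \<rho>\<^sup>2 * inner (G ?y) (?x - ?y)"
    "\<rho>\<^sup>2 * f ?x - \<rho>\<^sup>2 * f ?y - \<rho>\<^sup>2 * inner (G ?y) (?x - ?y) \<le> b / 2 * (\<rho>\<^sup>2 * (norm (?x - ?y))\<^sup>2)"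
    by (simp_all only: right_diff_distrib mult.left_commute)
  then show "a / 2 * (norm (x - y))\<^sup>2 \<le> \<rho>\<^sup>2 * f ?x - \<rho>\<^sup>2 * f ?y - inner (\<rho> *\<^sub>R embed (G ?y)) (x - y)"
    "\<rho>\<^sup>2 * f ?x - \<rho>\<^sup>2 * f ?y - inner (\<rho> *\<^sub>R embed (G ?y)) (x - y) \<le> b / 2 * (norm (x - y))\<^sup>2"
    unfolding n i by blast+
qed

text \<open>In the Hessian the outer factor \<open>\<rho>\<close> cancels against the inner
  derivative; what remains is the dilated argument, which divides the Lipschitz constant by
  \<open>\<rho>\<close>.\<close>

lemma lip_hessian_rescale:
  assumes G: "lip_hessian UNIV G \<tau>" and "\<rho> > 0" "\<tau> \<ge> 0"
  shows "lip_hessian (Rd 2) (\<lambda>x. \<rho> *\<^sub>R embed (G (plane x /\<^sub>R \<rho>))) (\<tau> / \<rho>)"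
proof -
  obtain H where H: "\<And>x. (G has_derivative blinfun_apply (H x)) (at x)"
    "H differentiable_on UNIV" "\<And>z w. norm (H z - H w) \<le> \<tau> * norm (z - w)"
    using G unfolding lip_hessian_def by auto
  define p where "p = Blinfun plane"
  define e where "e = Blinfun embed"
  have p: "blinfun_apply p = plane" and e: "blinfun_apply e = embed"
    by (simp_all add: p_def e_def bounded_linear_Blinfun_apply bounded_linear_plane bounded_linear_embed)
  have np: "norm p \<le> 1" and ne: "norm e \<le> 1"
    by (rule norm_blinfun_bound; simp add: p e norm_plane_le)+
  \<comment> \<open>Conjugation by \<open>embed\<close> and \<open>plane\<close> turns an operator
    on the plane into one on all sequences. Both maps have norm at most 1, so norms do not
    increase.\<close>
  define T where "T A = e o\<^sub>L A o\<^sub>L p" for A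
  have T: "bounded_linear T"
    unfolding T_def
    by (intro bounded_linear_compose[OF bounded_bilinear.bounded_linear_left[OF bounded_bilinear_blinfun_compose]]
        bounded_bilinear.bounded_linear_right[OF bounded_bilinear_blinfun_compose])
  have nT: "norm (T A) \<le> norm A" for A
  proof -
    have "norm (T A) \<le> norm (e o\<^sub>L A) * norm p"
      unfolding T_def by (rule norm_blinfun_compose)
    also have "\<dots> \<le> (norm e * norm A) * norm p"
      by (intro mult_right_mono norm_blinfun_compose) simp
    also have "\<dots> \<le> (1 * norm A) * 1"
      using np ne by (intro mult_mono) auto
    finally show ?thesis
      by simp
  qed
  have arg: "((\<lambda>x. plane x /\<^sub>R \<rho>) has_derivative (\<lambda>v. plane v /\<^sub>R \<rho>)) (at x within Rd 2)" for x
    by (intro has_derivative_scaleR_right bounded_linear_imp_has_derivative bounded_linear_plane)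
  show ?thesis
    unfolding lip_hessian_def
  proof (intro exI[of _ "\<lambda>x. T (H (plane x /\<^sub>R \<rho>))"] conjI ballI)
    fix x
    have "((\<lambda>x. \<rho> *\<^sub>R embed (G (plane x /\<^sub>R \<rho>))) has_derivative
        (\<lambda>v. \<rho> *\<^sub>R embed (H (plane x /\<^sub>R \<rho>) (plane v /\<^sub>R \<rho>)))) (at x within Rd 2)"
      by (intro has_derivative_scaleR_right bounded_linear.has_derivative[OF bounded_linear_embed]
          has_derivative_compose[OF arg H(1)])
    then show "((\<lambda>x. \<rho> *\<^sub>R embed (G (plane x /\<^sub>R \<rho>))) has_derivative T (H (plane x /\<^sub>R \<rho>))) (at x within Rd 2)"
      by (rule has_derivative_eq_rhs)
         (use \<open>\<rho> > 0\<close> in \<open>simp add: T_def p e fun_eq_iff blinfun.scaleR_right linear_scale[OF linear_embed]\<close>)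
  next
    have "(\<lambda>x. T (H (plane x /\<^sub>R \<rho>))) differentiable (at x within Rd 2)" for x
    proof -
      obtain D where "(H has_derivative D) (at (plane x /\<^sub>R \<rho>))"
        using H(2) by (auto simp: differentiable_on_def differentiable_def)
      then show ?thesis
        using bounded_linear.has_derivative[OF T has_derivative_compose[OF arg]]
        unfolding differentiable_def by blast
    qed
    then show "(\<lambda>x. T (H (plane x /\<^sub>R \<rho>))) differentiable_on Rd 2"
      by (simp add: differentiable_on_def)
  next
    fix z w
    have "norm (T (H (plane z /\<^sub>R \<rho>)) - T (H (plane w /\<^sub>R \<rho>)))
        \<le> norm (H (plane z /\<^sub>R \<rho>) - H (plane w /\<^sub>R \<rho>))"
      using nT by (simp add: linear_diff[OF bounded_linear.linear[OF T], symmetric])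
    also have "\<dots> \<le> \<tau> * norm (plane z /\<^sub>R \<rho> - plane w /\<^sub>R \<rho>)"
      by (rule H(3))
    also have "plane z /\<^sub>R \<rho> - plane w /\<^sub>R \<rho> = plane (z - w) /\<^sub>R \<rho>"
      by (simp add: linear_diff[OF linear_plane] scaleR_diff_right)
    also have "\<tau> * norm (plane (z - w) /\<^sub>R \<rho>) \<le> \<tau> * (norm (z - w) / \<rho>)"
      using norm_plane_le[of "z - w"] assms(2,3)
      by (intro mult_left_mono) (auto simp: divide_inverse_commute)
    finally show "norm (T (H (plane z /\<^sub>R \<rho>)) - T (H (plane w /\<^sub>R \<rho>))) \<le> \<tau> / \<rho> * norm (z - w)"
      by simp
  qed
qed

section \<open>Heavy-ball cycles on the roots of unity\<close>

lemma HB_eqI: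
  assumes "\<And>t. X (Suc (Suc t)) =
    X (Suc t) - \<gamma> *\<^sub>R grad E f (X (Suc t)) + \<beta> *\<^sub>R (X (Suc t) - X t)"
  shows "HB E \<gamma> \<beta> f (X 0) (X 1) t = X t"
proof -
  have "HB E \<gamma> \<beta> f (X 0) (X 1) t = X t \<and> HB E \<gamma> \<beta> f (X 0) (X 1) (Suc t) = X (Suc t)"
  proof (induction t)
    case (Suc t)
    then show ?case
      using assms[of t] by simp
  qed simp
  then show ?thesis ..
qed

lemma roots_cycle_periodic: "roots_cycle K (t mod K) = roots_cycle K t"
proof (cases "K = 0")
  case False
  have "real t = real K * real (t div K) + real (t mod K)"
    by (metis mult_div_mod_eq of_nat_add of_nat_mult)
  moreover have "(real K * real (t div K) + real (t mod K)) * (2 * pi / real K)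
      = real (t mod K) * (2 * pi / real K) + 2 * real (t div K) * pi"
    using False by (simp add: field_simps)
  ultimately have "real t * (2 * pi / real K) = real (t mod K) * (2 * pi / real K) + 2 * real (t div K) * pi"
    by simp
  then show ?thesis
    by (simp add: roots_cycle_def cos_add sin_add cos_2npi sin_2npi)
qed simp

text \<open>Addition theorems for the angles \<open>\<phi> + \<theta>\<close> and
  \<open>\<phi> - \<theta>\<close>. Eliminating the newest point turns a heavy-ball step into a
  linear equation for the gradient.\<close>

lemma roots_cycle_recurrence:
  "roots_cycle K (Suc (Suc t)) = (2 * cos (2 * pi / K)) *\<^sub>R roots_cycle K (Suc t) - roots_cycle K t"
proof -
  define \<theta> where "\<theta> = 2 * pi / real K"
  define \<phi> where "\<phi> = real (Suc t) * \<theta>"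
  have "real t * \<theta> = \<phi> - \<theta>" "real (Suc (Suc t)) * \<theta> = \<phi> + \<theta>"
    by (simp_all add: \<phi>_def algebra_simps)
  then show ?thesis
    unfolding roots_cycle_def \<theta>_def[symmetric] \<phi>_def[symmetric]
    by (simp add: vec_eq_iff forall_2 cos_add sin_add cos_diff sin_diff)
qed

lemma roots_cycle_HB_step_iff:
  fixes G :: "real^2"
  shows "roots_cycle K (Suc (Suc t)) = roots_cycle K (Suc t) - \<gamma> *\<^sub>R G
      + \<beta> *\<^sub>R (roots_cycle K (Suc t) - roots_cycle K t) \<longleftrightarrow>
    \<gamma> *\<^sub>R G = (1 + \<beta> - 2 * cos (2 * pi / K)) *\<^sub>R roots_cycle K (Suc t) + (1 - \<beta>) *\<^sub>R roots_cycle K t"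
  unfolding roots_cycle_recurrence by (simp add: vec_eq_iff forall_2) (auto simp: algebra_simps)

text \<open>Cycling depends on the function only through its gradients at the cycle points, which is
  what permits averaging and smoothing. Equations start at \<open>Suc t\<close> because
  \<open>z_0\<close> and \<open>z_1\<close> are given; the point with index 0 recurs at index
  \<open>K\<close>.\<close>

lemma roots_cycle_cycles_iff:
  assumes f: "quad_bounds UNIV f G a b"
  shows "HB_cycles_on UNIV \<gamma> \<beta> f K (roots_cycle K) \<longleftrightarrow>
    (\<exists>i<K. \<exists>j<K. roots_cycle K i \<noteq> roots_cycle K j) \<and>
    (\<forall>t. \<gamma> *\<^sub>R G (roots_cycle K (Suc t)) =
      (1 + \<beta> - 2 * cos (2 * pi / K)) *\<^sub>R roots_cycle K (Suc t) + (1 - \<beta>) *\<^sub>R roots_cycle K t)"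
    (is "_ \<longleftrightarrow> _ \<and> (\<forall>t. ?S t)")
proof -
  let ?x = "roots_cycle K" and ?z = "HB UNIV \<gamma> \<beta> f (roots_cycle K 0) (roots_cycle K 1)"
  have "?S t \<longleftrightarrow> ?x (Suc (Suc t)) =
      ?x (Suc t) - \<gamma> *\<^sub>R grad UNIV f (?x (Suc t)) + \<beta> *\<^sub>R (?x (Suc t) - ?x t)" for t
    unfolding roots_cycle_HB_step_iff quad_bounds_grad[OF subspace_UNIV f UNIV_I] ..
  moreover have "(\<forall>t. ?z t = ?x t) \<longleftrightarrow> (\<forall>t. ?x (Suc (Suc t)) =
      ?x (Suc t) - \<gamma> *\<^sub>R grad UNIV f (?x (Suc t)) + \<beta> *\<^sub>R (?x (Suc t) - ?x t))"
  proof
    assume "\<forall>t. ?z t = ?x t"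
    then show "\<forall>t. ?x (Suc (Suc t)) =
        ?x (Suc t) - \<gamma> *\<^sub>R grad UNIV f (?x (Suc t)) + \<beta> *\<^sub>R (?x (Suc t) - ?x t)"
      by (metis HB.simps(3))
  qed (blast intro: HB_eqI)
  ultimately show ?thesis
    unfolding HB_cycles_on_def roots_cycle_periodic by simp
qed

text \<open>
  The parameters \<open>(\<gamma>', \<beta>')\<close> are chosen so that, if \<open>f\<close> has the cycle for them, then
  \<open>(1 - s) f + s m \<parallel>\<cdot>\<parallel>\<^sup>2 / 2\<close> has it for \<open>(\<gamma>, \<beta>)\<close>; they tend to \<open>(\<gamma>, \<beta>)\<close> as \<open>s\<close> tends to 0.
  With \<open>m\<close> strictly between \<open>\<mu>\<close> and \<open>L\<close> the averaged function has room in both bounds.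
\<close>

lemma strict_cycle_exists:
  assumes "0 < \<mu>" "\<mu> < L" "K \<ge> 2" and int: "(\<gamma>, \<beta>) \<in> interior (\<Omega>_circ K \<mu> L)"
  obtains h G a b where "\<mu> < a" "b < L" "quad_bounds UNIV h G a b"
    "HB_cycles_on UNIV \<gamma> \<beta> h K (roots_cycle K)"
proof -
  define c where "c = cos (2 * pi / real K)"
  define m where "m = (\<mu> + L) / 2"
  \<comment> \<open>Cycling of the average asks that \<open>\<gamma> * (1 - s)\<close> times the
    gradient of \<open>f\<close> have coefficients
    \<open>1 + \<beta> - 2 * c - \<gamma> * s * m\<close> and \<open>1 - \<beta>\<close>. These must
    equal \<open>D s\<close> times \<open>1 + \<beta>' - 2 * c\<close> and
    \<open>1 - \<beta>'\<close>. Adding the two equations eliminates \<open>\<beta>'\<close> and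
    yields \<open>D s = 1 - \<gamma> * s * k\<close>; the second one then gives
    \<open>\<beta>'\<close>.\<close>
  define k where "k = m / (2 * (1 - c))"
  define D where "D s = 1 - \<gamma> * s * k" for s
  \<comment> \<open>For \<open>K \<ge> 2\<close> the angle lies in \<open>(0, pi]\<close>, so the
    denominator of \<open>k\<close> is positive.\<close>
  have "cos (2 * pi / real K) < cos 0"
    using \<open>K \<ge> 2\<close> by (intro cos_monotone_0_pi) (auto simp: field_simps)
  then have c: "c < 1"
    by (simp add: c_def)
  have "((\<lambda>s. (\<gamma> * (1 - s) / D s, (\<beta> - \<gamma> * s * k) / D s)) \<longlongrightarrow>
      (\<gamma> * (1 - 0) / D 0, (\<beta> - \<gamma> * 0 * k) / D 0)) (at_right 0)"
    unfolding D_def by (intro tendsto_intros) auto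
  then have "((\<lambda>s. (\<gamma> * (1 - s) / D s, (\<beta> - \<gamma> * s * k) / D s)) \<longlongrightarrow> (\<gamma>, \<beta>)) (at_right 0)"
    by (simp add: D_def)
  then have "\<forall>\<^sub>F s in at_right 0. (\<gamma> * (1 - s) / D s, (\<beta> - \<gamma> * s * k) / D s) \<in> interior (\<Omega>_circ K \<mu> L)"
    by (rule topological_tendstoD[OF _ open_interior int])
  moreover have "(D \<longlongrightarrow> D 0) (at_right 0)"
    unfolding D_def by (intro tendsto_intros)
  then have "\<forall>\<^sub>F s in at_right 0. 0 < D s"
    by (rule order_tendstoD) (simp add: D_def)
  moreover have "\<forall>\<^sub>F s::real in at_right 0. 0 < s \<and> s < 1"
    unfolding eventually_at_right_field by (intro exI[of _ 1]) auto
  ultimately have "\<forall>\<^sub>F s in at_right 0. (\<gamma> * (1 - s) / D s, (\<beta> - \<gamma> * s * k) / D s) \<in> \<Omega>_circ K \<mu> L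
      \<and> 0 < D s \<and> 0 < s \<and> s < 1"
    by eventually_elim (use interior_subset in blast)
  from eventually_happens'[OF trivial_limit_at_right_real this]
  obtain s where s: "(\<gamma> * (1 - s) / D s, (\<beta> - \<gamma> * s * k) / D s) \<in> \<Omega>_circ K \<mu> L" "0 < D s" "0 < s" "s < 1"
    by blast
  define \<gamma>' where "\<gamma>' = \<gamma> * (1 - s) / D s"
  define \<beta>' where "\<beta>' = (\<beta> - \<gamma> * s * k) / D s"
  obtain f where f: "f \<in> F_class UNIV \<mu> L" "HB_cycles_on UNIV \<gamma>' \<beta>' f K (roots_cycle K)"
    using s(1) unfolding \<Omega>_circ_def \<gamma>'_def \<beta>'_def by auto
  define F where "F = grad UNIV f"
  have fF: "quad_bounds UNIV f F \<mu> L"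
    unfolding F_def by (rule F_class_imp_quad_bounds[OF f(1)])
  define h where "h x = (1 - s) * f x + s * m * ((norm x)\<^sup>2 / 2)" for x
  define G where "G x = (1 - s) *\<^sub>R F x + (s * m) *\<^sub>R x" for x
  have m: "\<mu> < m" "m < L"
    using \<open>\<mu> < L\<close> by (auto simp: m_def)
  have "quad_bounds UNIV (\<lambda>x. s * m * ((norm x)\<^sup>2 / 2)) (\<lambda>x::real^2. (s * m) *\<^sub>R x) (s * m) (s * m)"
    using quad_bounds_scaleR[OF subspace_UNIV quad_bounds_norm_square, of "s * m"] m s(3) \<open>0 < \<mu>\<close> by simp
  from quad_bounds_add[OF subspace_UNIV quad_bounds_scaleR[OF subspace_UNIV fF, of "1 - s"] this]
  have hG: "quad_bounds UNIV h G ((1 - s) * \<mu> + s * m) ((1 - s) * L + s * m)"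
    unfolding h_def G_def using s(4) by simp
  have cyc: "(\<exists>i<K. \<exists>j<K. roots_cycle K i \<noteq> roots_cycle K j)"
    "\<And>t. \<gamma>' *\<^sub>R F (roots_cycle K (Suc t)) =
      (1 + \<beta>' - 2 * c) *\<^sub>R roots_cycle K (Suc t) + (1 - \<beta>') *\<^sub>R roots_cycle K t"
    using f(2) unfolding roots_cycle_cycles_iff[OF fF] c_def by auto
  have "\<gamma> *\<^sub>R G (roots_cycle K (Suc t)) =
      (1 + \<beta> - 2 * c) *\<^sub>R roots_cycle K (Suc t) + (1 - \<beta>) *\<^sub>R roots_cycle K t" for t
  proof -
    let ?x = "roots_cycle K (Suc t)" and ?y = "roots_cycle K t"
    have D\<beta>': "D s * \<beta>' = \<beta> - \<gamma> * s * k"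
      using s(2) by (simp add: \<beta>'_def)
    have D1: "D s * (1 + \<beta>' - 2 * c) = 1 + \<beta> - 2 * c - \<gamma> * (s * m)"
    proof -
      have "D s * (1 + \<beta>' - 2 * c) = D s + (\<beta> - \<gamma> * s * k) - 2 * c * D s"
        using D\<beta>' by (simp add: algebra_simps)
      also have "\<dots> = 1 + \<beta> - 2 * c - \<gamma> * s * (k * (2 * (1 - c)))"
        by (simp add: D_def algebra_simps)
      also have "k * (2 * (1 - c)) = m"
        using c by (simp add: k_def)
      finally show ?thesis
        by (simp add: mult.assoc)
    qed
    have D2: "D s * (1 - \<beta>') = 1 - \<beta>"
      by (simp add: right_diff_distrib D\<beta>') (simp add: D_def)
    have "\<gamma> *\<^sub>R G ?x = D s *\<^sub>R (\<gamma>' *\<^sub>R F ?x) + (\<gamma> * (s * m)) *\<^sub>R ?x"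
      using s(2) by (simp add: G_def \<gamma>'_def scaleR_add_right)
    also have "\<dots> = (D s * (1 + \<beta>' - 2 * c)) *\<^sub>R ?x + (D s * (1 - \<beta>')) *\<^sub>R ?y + (\<gamma> * (s * m)) *\<^sub>R ?x"
      unfolding cyc(2) by (simp add: scaleR_add_right)
    also have "\<dots> = (1 + \<beta> - 2 * c) *\<^sub>R ?x + (1 - \<beta>) *\<^sub>R ?y"
      unfolding D1 D2 by (simp add: scaleR_diff_left)
    finally show ?thesis .
  qed
  then have "HB_cycles_on UNIV \<gamma> \<beta> h K (roots_cycle K)"
    unfolding roots_cycle_cycles_iff[OF hG] c_def using cyc(1) by blast
  moreover have "s * \<mu> < s * m" "s * m < s * L"
    using m s(3) by simp_all
  then have "\<mu> < (1 - s) * \<mu> + s * m" "(1 - s) * L + s * m < L"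
    by (simp_all add: left_diff_distrib)
  ultimately show thesis
    using that hG by blast
qed

theorem theorem5p2:
  fixes \<mu> L \<gamma> \<beta> :: real and K :: nat
  assumes "0 < \<mu>" and "\<mu> < L" and "K \<ge> 2"
    and "(\<gamma>, \<beta>) \<in> interior (\<Omega>_circ K \<mu> L)"
  shows "(\<exists>\<tau>>0. \<exists>\<phi> \<in> F_tau_class (UNIV :: (real^2) set) \<mu> L \<tau>.
            HB_cycles_on UNIV \<gamma> \<beta> \<phi> K (roots_cycle K))
       \<and> (\<forall>\<tau>>0. HB_has_cycle \<gamma> \<beta> (\<lambda>d. F_tau_class (Rd d) \<mu> L \<tau>))"
proof -
  obtain h G a b where h: "\<mu> < a" "b < L" "quad_bounds UNIV h G a b"
    "HB_cycles_on UNIV \<gamma> \<beta> h K (roots_cycle K)"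
    using strict_cycle_exists[OF assms] by metis
  have "range (roots_cycle K) \<subseteq> roots_cycle K ` {..<K}"
  proof
    fix p assume "p \<in> range (roots_cycle K)"
    then obtain t where "p = roots_cycle K (t mod K)"
      by (auto simp: roots_cycle_periodic)
    then show "p \<in> roots_cycle K ` {..<K}"
      using \<open>K \<ge> 2\<close> by simp
  qed
  then have "finite (range (roots_cycle K))"
    using finite_surj by blast
  then obtain \<phi> \<Phi> \<sigma> where \<phi>: "\<sigma> > 0" "quad_bounds UNIV \<phi> \<Phi> \<mu> L" "lip_hessian UNIV \<Phi> \<sigma>"
    "\<And>t. \<Phi> (roots_cycle K t) = G (roots_cycle K t)"
    using smooth_interpolation[OF h(3,1,2)] by (metis rangeI)
  \<comment> \<open>\<open>\<Phi>\<close> and \<open>G\<close> agree at all cycle points, so the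
    gradient equations for \<open>h\<close> are those for \<open>\<phi>\<close>.\<close>
  have cyc: "HB_cycles_on UNIV \<gamma> \<beta> \<phi> K (roots_cycle K)"
    using h(4) \<phi>(4) by (simp add: roots_cycle_cycles_iff[OF h(3)] roots_cycle_cycles_iff[OF \<phi>(2)])
  have "HB_has_cycle \<gamma> \<beta> (\<lambda>d. F_tau_class (Rd d) \<mu> L \<tau>)" if "\<tau> > 0" for \<tau>
  proof -
    \<comment> \<open>Rescaling divides the Lipschitz constant \<open>\<sigma>\<close> of the
      Hessian by \<open>\<rho>\<close>, and this choice makes the result exactly
      \<open>\<tau>\<close>.\<close>
    define \<rho> where "\<rho> = \<sigma> / \<tau>"
    have \<rho>: "\<rho> > 0" "\<sigma> / \<rho> = \<tau>"
      using that \<phi>(1) by (auto simp: \<rho>_def)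
    define f where "f x = \<rho>\<^sup>2 * \<phi> (plane x /\<^sub>R \<rho>)" for x
    define X where "X t = \<rho> *\<^sub>R embed (roots_cycle K t)" for t
    have f: "quad_bounds (Rd 2) f (\<lambda>x. \<rho> *\<^sub>R embed (\<Phi> (plane x /\<^sub>R \<rho>))) \<mu> L"
      unfolding f_def by (rule quad_bounds_rescale[OF \<phi>(2) \<rho>(1)])
    have "f \<in> F_tau_class (Rd 2) \<mu> L \<tau>"
      using lip_hessian_rescale[OF \<phi>(3) \<rho>(1)] \<phi>(1) \<rho>(2)
      by (intro F_tau_classI[OF subspace_Rd f]) simp
    moreover have XR: "X t \<in> Rd 2" for t
      unfolding X_def by (intro subspace_scale[OF subspace_Rd] embed_in_Rd)
    have grad: "grad (Rd 2) f (X t) = \<rho> *\<^sub>R embed (\<Phi> (roots_cycle K t))" for t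
      using quad_bounds_grad[OF subspace_Rd f XR[of t]] \<rho>(1)
      by (simp add: X_def linear_scale[OF linear_plane])
    have step: "X (Suc (Suc t)) =
        X (Suc t) - \<gamma> *\<^sub>R grad (Rd 2) f (X (Suc t)) + \<beta> *\<^sub>R (X (Suc t) - X t)" for t
    proof -
      have "roots_cycle K (Suc (Suc t)) = roots_cycle K (Suc t) - \<gamma> *\<^sub>R \<Phi> (roots_cycle K (Suc t))
          + \<beta> *\<^sub>R (roots_cycle K (Suc t) - roots_cycle K t)"
        using cyc unfolding roots_cycle_HB_step_iff roots_cycle_cycles_iff[OF \<phi>(2)] by blast
      \<comment> \<open>The linear map \<open>\<rho> *\<^sub>R embed v\<close> sends both the cycle
        points and the gradients of \<open>\<phi>\<close> to those of \<open>f\<close>, hence the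
        recursion to the recursion.\<close>
      from arg_cong[OF this, of "\<lambda>v. \<rho> *\<^sub>R embed v"] show ?thesis
        unfolding grad unfolding X_def
        by (simp add: linear_add[OF linear_embed] linear_diff[OF linear_embed] linear_scale[OF linear_embed]
            algebra_simps)
    qed
    have "HB_cycles_on (Rd 2) \<gamma> \<beta> f K X"
      unfolding HB_cycles_on_def
    proof (intro conjI allI impI)
      obtain i j where "i < K" "j < K" "roots_cycle K i \<noteq> roots_cycle K j"
        using cyc by (auto simp: HB_cycles_on_def)
      moreover from this have "X i \<noteq> X j"
        using \<rho>(1) by (auto simp: X_def dest: arg_cong[of _ _ plane])
      ultimately show "\<exists>i<K. \<exists>j<K. X i \<noteq> X j"
        by blast
    next
      fix t
      have "HB (Rd 2) \<gamma> \<beta> f (X 0) (X 1) t = X t"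
        by (rule HB_eqI[of X, OF step])
      then show "HB (Rd 2) \<gamma> \<beta> f (X 0) (X 1) t = X (t mod K)"
        by (simp add: X_def roots_cycle_periodic)
    qed (rule XR)
    ultimately show ?thesis
      unfolding HB_has_cycle_def by (intro exI[of _ "2::nat"]) auto
  qed
  moreover have "\<phi> \<in> F_tau_class UNIV \<mu> L \<sigma>"
    by (rule F_tau_classI[OF subspace_UNIV \<phi>(2,3)])
  ultimately show ?thesis
    using \<phi>(1) cyc by blast
qed

end
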